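(* Assume (H1), (H2) and (H3). Let $v(t,x)$ be an arbitrary generalized traveling wave of $u_t=u_{xx}+f(t,u)$. Then there exists some $\zeta_*\in\mathbb{R}$ such that $v(t,x)=u^f(t,x+\zeta_* )$ for all $x\in\mathbb{R}$ and $t\in\mathbb{R}$. Hence generalized traveling waves of $u_t=u_{xx}+f(t,u)$ are unique up to space translations.
   Context: Let $f:\mathbb{R}\times\mathbb{R}\to\mathbb{R}$, $(t,u)\mapsto f(t,u)$, and consider the equation (E): $u_t=u_{xx}+f(t,u)$, $x\in\mathbb{R}$, $t\in\mathbb{R}$. Assumptions. (H1) There is $\theta\in(0,1)$ (the ignition temperature) such that for all $t\in\mathbb{R}$: $f(t,u)=0$ for $u\in(-\infty,\theta]\cup\{1\}$, $f(t,u)>0$ for $u\in(\theta,1)$, $f(t,u)<0$ for $u>1$. The family of functions $\{f(\cdot,u):u\in\mathbb{R}\}$ is locally uniformly Hölder continuous; the family $\{f(t,\cdot):t\in\mathbb{R}\}$ is locally uniformly Lipschitz continuous; for any $t\in\mathbb{R}$, $f(t,u)$ is continuously differentiable for $u\ge\theta$. (H2) There are Lipschitz continuous functions $f_{\inf},f_{\sup}\in C^1([\theta,\infty),\mathbb{R})$ with $f_{\inf}(u)=0=f_{\sup}(u)$ for $u\in[0,\theta]\cup\{1\}$, $0<(f_{\inf})_u^+(\theta)\le(f_{\sup})_u^+(\theta)$ (right derivatives), $0>(f_{\inf})_u(1)\ge(f_{\sup})_u(1)$, $0<f_{\inf}(u)<f_{\sup}(u)$ for $u\in(\theta,1)$,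 such that $f_{\inf}(u)\le f(t,u)\le f_{\sup}(u)$ for $u\in[\theta,1]$, $t\in\mathbb{R}$. (H3) There exist $\theta_*\in(\theta,1)$ and $\beta>0$ such that $f_u(t,u)\le-\beta$ for $u\ge\theta_*$ and $t\in\mathbb{R}$. Generalized traveling wave: a global-in-time classical solution $u(t,x)$ of (E) on $\mathbb{R}\times\mathbb{R}$ with values in $(0,1)$ for which there is a function $\xi:\mathbb{R}\to\mathbb{R}$ (an interface location function) such that $\lim_{x\to-\infty}u(t,x+\xi(t))=1$ and $\lim_{x\to\infty}u(t,x+\xi(t))=0$ uniformly in $t\in\mathbb{R}$. The wave $u^f$: under (H1), (H2) it is known that (E) has a generalized traveling wave $u^f(t,x)$ with a continuously differentiable interface location function $\xi^f:\mathbb{R}\to\mathbb{R}$ satisfying $u^f(t,\xi^f(t))=\theta$ for all $t$ and $\sup_t|\dot\xi^f(t)|<\infty$, and with the properties: (i) $u^f_x(t,x)<0$ for all $t,x$; (ii) for any $M>0$ there is $C(M)>0$ with $u^f_x(t,x+\xi^f(t))<-C(M)$ for $x\in[-M,M]$, $t\in\mathbb{R}$; (iii) there is a continuous strictly decreasing $w:\mathbb{R}\to(0,1)$ with $w(x)\ge1-c_1e^{c_2x}$ for $x\le-c_3$ for some $c_1,c_2,c_3>0$ and $w(x)=\theta e^{-c_0x}$ for $x\ge0$ for some $c_0>0$, such that $u^f(t,x+\xi^f(t))\ge w(x)$ for $x\le0$ and $u^f(t,x+\xi^f(t))\le w(x)$ for $x\ge0$, for all $t$; (iv) there is $C>0$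 with $u^f_x(t,x+\xi^f(t))\ge-Cw(x)$ for $x\ge0$ and all $t$. Throughout $u^f$ denotes this fixed wave. *)

theory Defs
  imports "HOL-Analysis.Analysis"
begin

text \<open>The derivative is taken relative to \<open>S\<close>, hence one-sided at boundary points of an interval.\<close>

definition C1_within :: "real set \<Rightarrow> (real \<Rightarrow> real) \<Rightarrow> bool" where
  "C1_within S g \<longleftrightarrow>
     (\<exists>g'. (\<forall>u\<in>S. (g has_real_derivative g' u) (at u within S)) \<and> continuous_on S g')"

text \<open>A family of functions is locally uniformly Hoelder (Lipschitz) continuous if on every compact
  set of arguments all its members share one Hoelder exponent and constant (one Lipschitz constant).\<close>

definition loc_unif_hoelder :: "('i \<Rightarrow> real \<Rightarrow> real) \<Rightarrow> bool" where
  "loc_unif_hoelder F \<longleftrightarrow>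
     (\<forall>K. compact K \<longrightarrow>
        (\<exists>\<alpha> C. 0 < \<alpha> \<and> \<alpha> \<le> 1 \<and>
           (\<forall>i. \<forall>s\<in>K. \<forall>t\<in>K. \<bar>F i s - F i t\<bar> \<le> C * \<bar>s - t\<bar> powr \<alpha>)))"

definition loc_unif_lipschitz :: "('i \<Rightarrow> real \<Rightarrow> real) \<Rightarrow> bool" where
  "loc_unif_lipschitz F \<longleftrightarrow> (\<forall>K. compact K \<longrightarrow> (\<exists>L. \<forall>i. L-lipschitz_on K (F i)))"

text \<open>The nonlinearity is written \<open>f t u\<close>; \<open>\<theta>\<close> is the ignition temperature, which
  (H1), (H2), (H3) and the reference wave share.\<close>

definition H1 :: "(real \<Rightarrow> real \<Rightarrow> real) \<Rightarrow> real \<Rightarrow> bool" where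
  "H1 f \<theta> \<longleftrightarrow>
     0 < \<theta> \<and> \<theta> < 1 \<and>
     (\<forall>t. (\<forall>u\<in>{..\<theta>} \<union> {1}. f t u = 0) \<and>
          (\<forall>u\<in>{\<theta><..<1}. f t u > 0) \<and>
          (\<forall>u>1. f t u < 0)) \<and>
     loc_unif_hoelder (\<lambda>u t. f t u) \<and>
     loc_unif_lipschitz f \<and>
     (\<forall>t. C1_within {\<theta>..} (f t))"

text \<open>The bounding functions are prescribed on \<open>[0, \<theta>]\<close> and on \<open>[\<theta>, \<infinity>)\<close>, so
  their domain is \<open>[0, \<infinity>)\<close>; their values at negative arguments are irrelevant.\<close>

definition H2 :: "(real \<Rightarrow> real \<Rightarrow> real) \<Rightarrow> real \<Rightarrow> bool" where
  "H2 f \<theta> \<longleftrightarrow>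
     (\<exists>f_inf f_sup :: real \<Rightarrow> real.
        (\<exists>L. L-lipschitz_on {0..} f_inf) \<and> (\<exists>L. L-lipschitz_on {0..} f_sup) \<and>
        C1_within {\<theta>..} f_inf \<and> C1_within {\<theta>..} f_sup \<and>
        (\<forall>u\<in>{0..\<theta>} \<union> {1}. f_inf u = 0 \<and> f_sup u = 0) \<and>
        (\<exists>a b. (f_inf has_real_derivative a) (at_right \<theta>) \<and>
               (f_sup has_real_derivative b) (at_right \<theta>) \<and> 0 < a \<and> a \<le> b) \<and>
        0 > deriv f_inf 1 \<and> deriv f_inf 1 \<ge> deriv f_sup 1 \<and>
        (\<forall>u\<in>{\<theta><..<1}. 0 < f_inf u \<and> f_inf u < f_sup u) \<and>
        (\<forall>t. \<forall>u\<in>{\<theta>..1}. f_inf u \<le> f t u \<and> f t u \<le> f_sup u))"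

text \<open>Under (H1) every \<open>f t\<close> is differentiable at all points beyond \<open>\<theta>\<close>, so that
  \<open>deriv (f t) u\<close> is the genuine partial derivative here.\<close>

definition H3 :: "(real \<Rightarrow> real \<Rightarrow> real) \<Rightarrow> real \<Rightarrow> bool" where
  "H3 f \<theta> \<longleftrightarrow>
     (\<exists>\<theta>' \<beta>. \<theta> < \<theta>' \<and> \<theta>' < 1 \<and> 0 < \<beta> \<and> (\<forall>t. \<forall>u\<ge>\<theta>'. deriv (f t) u \<le> - \<beta>))"

text \<open>Global-in-time classical solutions of \<open>u_t = u_xx + f(t,u)\<close>: the derivatives
  \<open>u_t, u_x, u_xx\<close> exist and are jointly continuous on the whole plane.\<close>

definition entire_classical_solution ::
  "(real \<Rightarrow> real \<Rightarrow> real) \<Rightarrow> (real \<Rightarrow> real \<Rightarrow> real) \<Rightarrow> bool" where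
  "entire_classical_solution f u \<longleftrightarrow>
     (\<exists>u_t u_x u_xx :: real \<Rightarrow> real \<Rightarrow> real.
        (\<forall>t x. ((\<lambda>s. u s x) has_real_derivative u_t t x) (at t) \<and>
               (u t has_real_derivative u_x t x) (at x) \<and>
               (u_x t has_real_derivative u_xx t x) (at x) \<and>
               u_t t x = u_xx t x + f t (u t x)) \<and>
        continuous_on UNIV (\<lambda>(t, x). u_t t x) \<and>
        continuous_on UNIV (\<lambda>(t, x). u_x t x) \<and>
        continuous_on UNIV (\<lambda>(t, x). u_xx t x))"

definition interface_location :: "(real \<Rightarrow> real \<Rightarrow> real) \<Rightarrow> (real \<Rightarrow> real) \<Rightarrow> bool" where
  "interface_location u \<xi> \<longleftrightarrow>
     uniform_limit UNIV (\<lambda>x t. u t (x + \<xi> t)) (\<lambda>_. 1) at_bot \<and>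
     uniform_limit UNIV (\<lambda>x t. u t (x + \<xi> t)) (\<lambda>_. 0) at_top"

definition generalized_traveling_wave ::
  "(real \<Rightarrow> real \<Rightarrow> real) \<Rightarrow> (real \<Rightarrow> real \<Rightarrow> real) \<Rightarrow> bool" where
  "generalized_traveling_wave f u \<longleftrightarrow>
     entire_classical_solution f u \<and>
     (\<forall>t x. u t x \<in> {0<..<1}) \<and>
     (\<exists>\<xi>. interface_location u \<xi>)"

text \<open>The properties of the wave \<open>u^f\<close> (here \<open>u\<close>) and of its interface location function
  \<open>\<xi>^f\<close> (here \<open>\<xi>\<close>). The last two properties refer to the same profile \<open>w\<close>.\<close>

definition reference_wave ::
  "(real \<Rightarrow> real \<Rightarrow> real) \<Rightarrow> real \<Rightarrow> (real \<Rightarrow> real \<Rightarrow> real) \<Rightarrow> (real \<Rightarrow> real) \<Rightarrow> bool" where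
  "reference_wave f \<theta> u \<xi> \<longleftrightarrow>
     generalized_traveling_wave f u \<and>
     interface_location u \<xi> \<and>
     \<xi> C1_differentiable_on UNIV \<and>
     bounded (range (deriv \<xi>)) \<and>
     (\<forall>t. u t (\<xi> t) = \<theta>) \<and>
     (\<forall>t x. deriv (u t) x < 0) \<and>
     (\<forall>M>0. \<exists>C>0. \<forall>t. \<forall>x\<in>{-M..M}. deriv (u t) (x + \<xi> t) < - C) \<and>
     (\<exists>w :: real \<Rightarrow> real.
        continuous_on UNIV w \<and> strict_antimono_on UNIV w \<and> (\<forall>x. w x \<in> {0<..<1}) \<and>
        (\<exists>c\<^sub>1>0. \<exists>c\<^sub>2>0. \<exists>c\<^sub>3>0. \<forall>x\<le>-c\<^sub>3. w x \<ge> 1 - c\<^sub>1 * exp (c\<^sub>2 * x)) \<and>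
        (\<exists>c\<^sub>0>0. \<forall>x\<ge>0. w x = \<theta> * exp (- c\<^sub>0 * x)) \<and>
        (\<forall>t. \<forall>x\<le>0. u t (x + \<xi> t) \<ge> w x) \<and>
        (\<forall>t. \<forall>x\<ge>0. u t (x + \<xi> t) \<le> w x) \<and>
        (\<exists>C>0. \<forall>t. \<forall>x\<ge>0. deriv (u t) (x + \<xi> t) \<ge> - C * w x))"

end

theory Submission
  imports Defs "HOL-Real_Asymp.Real_Asymp"
begin

text \<open>A wave \<open>v\<close> is squeezed between translates of the reference wave \<open>U\<close>, and the optimal translates are
  shown to coincide. Everything is done by comparison, and three facts make this work.

  First, fronts move with positive average speed (\<open>front_speed_positive\<close>), so ahead of its interface every wave decays
  exponentially (\<open>wave_tail\<close>).

  Secondly, \<open>U\<close> is stable in the following sense (\<open>shifted_comparison\<close>). If \<open>v\<close> is below \<open>U\<close> at one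
  time, up to an error of size \<open>q\<close> that decays exponentially ahead of the interface, then at all
  later times it is below the translate of \<open>U\<close> by a multiple \<open>q B\<close>, up to a truncated exponential that travels at a speed
  \<open>\<alpha>\<close> less than that of the front. Behind the interface this error is harmless because \<open>f\<close>
  decreases in \<open>u\<close> there, ahead of it because there is no reaction, and near the interface it decays in
  time since the front outruns it. As all solutions are defined for all times, starting at
  times tending to minus infinity removes the error altogether (\<open>ancient_comparison\<close>). The same holds
  for lower bounds. This yields two translates of \<open>U\<close> with \<open>v\<close> in between
  (\<open>wave_between_translates\<close>).

  Thirdly, a gap between \<open>v\<close> and a translate, even at a single point, spreads within one time unit
  to a lower bound on a whole window that is uniform in time and place
  (\<open>positivity_spreads\<close>). Outside a large window the
  increments of \<open>U\<close> are so small (\<open>U_increment_left\<close>, \<open>U_increment_right\<close>) that they are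
  errors of the admissible kind. So if a gap of fixed size recurs at arbitrarily early times, then the translate
  can be improved (\<open>shift_improvement\<close>).

  If the optimal translates above and below \<open>v\<close> were different, then at each time \<open>v\<close> would be
  separated from one of them near the interface, and one of the two cases would recur at arbitrarily early times,
  contradicting optimality (\<open>wave_is_translate\<close>).\<close>

section \<open>A parabolic comparison principle\<close>

text \<open>\<open>heat_op u t x r\<close> reads \<open>u_t - u_xx = r\<close> at the point \<open>(t, x)\<close>. As a relation it composes:
  the value for a sum, a translate or a reflection is read off from the values of the parts. The first
  space derivative is required on the whole line because \<open>u_xx\<close> is a derivative of it.\<close>
definition heat_op :: "(real \<Rightarrow> real \<Rightarrow> real) \<Rightarrow> real \<Rightarrow> real \<Rightarrow> real \<Rightarrow> bool" where
  "heat_op u t x r \<longleftrightarrow>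
     (\<exists>dt dx dxx. ((\<lambda>s. u s x) has_real_derivative dt) (at t) \<and>
        (\<forall>y. (u t has_real_derivative dx y) (at y)) \<and>
        (dx has_real_derivative dxx) (at x) \<and> r = dt - dxx)"

lemma heat_opI:
  assumes "((\<lambda>s. u s x) has_real_derivative dt) (at t)"
    and "\<And>y. (u t has_real_derivative dx y) (at y)"
    and "(dx has_real_derivative dxx) (at x)" and "r = dt - dxx"
  shows "heat_op u t x r"
  using assms unfolding heat_op_def by blast

lemma heat_op_add:
  assumes "heat_op u t x r" and "heat_op v t x s"
  shows "heat_op (\<lambda>t x. u t x + v t x) t x (r + s)"
proof -
  obtain a b c where u: "((\<lambda>s. u s x) has_real_derivative a) (at t)"
    "\<And>y. (u t has_real_derivative b y) (at y)" "(b has_real_derivative c) (at x)" "r = a - c"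
    using assms(1) unfolding heat_op_def by blast
  obtain a' b' c' where v: "((\<lambda>s. v s x) has_real_derivative a') (at t)"
    "\<And>y. (v t has_real_derivative b' y) (at y)" "(b' has_real_derivative c') (at x)" "s = a' - c'"
    using assms(2) unfolding heat_op_def by blast
  show ?thesis
    by (rule heat_opI[of _ _ "a + a'" _ "\<lambda>y. b y + b' y" "c + c'"])
      (use u v in \<open>auto intro!: DERIV_add\<close>)
qed

lemma heat_op_cmult:
  assumes "heat_op u t x r"
  shows "heat_op (\<lambda>t x. k * u t x) t x (k * r)"
proof -
  obtain a b c where u: "((\<lambda>s. u s x) has_real_derivative a) (at t)"
    "\<And>y. (u t has_real_derivative b y) (at y)" "(b has_real_derivative c) (at x)" "r = a - c"
    using assms(1) unfolding heat_op_def by blast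
  show ?thesis
    by (rule heat_opI[of _ _ "k * a" _ "\<lambda>y. k * b y" "k * c"])
      (use u in \<open>auto intro!: DERIV_cmult simp: right_diff_distrib\<close>)
qed

lemma heat_op_diff:
  assumes "heat_op u t x r" and "heat_op v t x s"
  shows "heat_op (\<lambda>t x. u t x - v t x) t x (r - s)"
  using heat_op_add[OF assms(1) heat_op_cmult[OF assms(2), of "-1"]] by simp

lemma heat_op_const: "heat_op (\<lambda>t x. k) t x 0"
  by (rule heat_opI[of _ _ 0 _ "\<lambda>_. 0" 0]) auto

lemma heat_op_affine_space:
  assumes "heat_op u t (a + \<sigma> * x) r" and "\<sigma> = 1 \<or> \<sigma> = -1"
  shows "heat_op (\<lambda>t x. u t (a + \<sigma> * x)) t x r"
proof -
  obtain d b c where u: "((\<lambda>s. u s (a + \<sigma> * x)) has_real_derivative d) (at t)"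
    "\<And>y. (u t has_real_derivative b y) (at y)" "(b has_real_derivative c) (at (a + \<sigma> * x))"
    "r = d - c"
    using assms(1) unfolding heat_op_def by blast
  have lin: "((\<lambda>y. a + \<sigma> * y) has_real_derivative \<sigma>) (at y)" for y
    by (auto intro!: derivative_eq_intros)
  have "((\<lambda>y. \<sigma> * b (a + \<sigma> * y)) has_real_derivative \<sigma> * (c * \<sigma>)) (at x)"
    by (intro DERIV_cmult DERIV_chain2[OF u(3) lin])
  moreover have "\<sigma> * (c * \<sigma>) = c" using assms(2) by auto
  ultimately have 2: "((\<lambda>y. \<sigma> * b (a + \<sigma> * y)) has_real_derivative c) (at x)" by simp
  have 1: "((\<lambda>y. u t (a + \<sigma> * y)) has_real_derivative \<sigma> * b (a + \<sigma> * y)) (at y)" for y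
    using DERIV_chain2[OF u(2)[of "a + \<sigma> * y"] lin[of y]]
    by (simp only: mult.commute[of \<sigma> "b (a + \<sigma> * y)"])
  show ?thesis by (rule heat_opI[OF u(1) 1 2 u(4)])
qed

lemma second_derivative_nonneg_at_local_min:
  fixes g g' :: "real \<Rightarrow> real"
  assumes g: "\<And>y. (g has_real_derivative g' y) (at y)"
    and g': "(g' has_real_derivative l) (at x)"
    and d: "d > 0" and min: "\<And>y. \<bar>x - y\<bar> < d \<Longrightarrow> g x \<le> g y"
  shows "0 \<le> l"
proof (rule ccontr)
  assume "\<not> 0 \<le> l"
  have z: "g' x = 0" using DERIV_local_min[OF g d] min by blast
  obtain e where e: "e > 0" "\<And>h. 0 < h \<Longrightarrow> h < e \<Longrightarrow> g' (x + h) < g' x"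
    using DERIV_neg_dec_right[OF g'] \<open>\<not> 0 \<le> l\<close> by force
  define y where "y = x + min d e / 2"
  have y: "x < y" "y - x < d" "y - x < e" using d e(1) by (auto simp: y_def min_def field_simps)
  obtain w where w: "x < w" "w < y" "g y - g x = (y - x) * g' w"
    using MVT2[of x y g g'] y(1) g by blast
  have "g' w < 0" using e(2)[of "w - x"] w y z by auto
  then have "g y < g x" using w(3) y(1) mult_pos_neg[of "y - x" "g' w"] by linarith
  then show False using min[of y] y by auto
qed

text \<open>If \<open>D\<close> were negative somewhere, then
  \<open>F = exp (- \<Lambda> (t - s)) D + \<epsilon> (x\<^sup>2 + 3 (t - s))\<close> would have a negative minimum for small \<open>\<epsilon>\<close>: the
  quadratic term gives compactness on the unbounded line, and its contribution \<open>3 \<epsilon> - 2 \<epsilon> > 0\<close> to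
  \<open>F_t - F_xx\<close> contradicts the signs of the derivatives at a minimum. Since only these signs matter,
  the differential inequality may be checked on any smooth \<open>E\<close> that touches \<open>D\<close> from above, which
  admits barriers with kinks. The boundary of \<open>\<Omega>\<close> enters through the
  requirement that \<open>D\<close> can be negative only at interior points.\<close>
lemma parabolic_comparison_test:
  fixes D :: "real \<Rightarrow> real \<Rightarrow> real"
  assumes cl: "closed \<Omega>"
    and cont: "continuous_on (\<Omega> \<inter> {s..T} \<times> UNIV) (\<lambda>(t, x). D t x)"
    and lb: "\<And>t x. (t, x) \<in> \<Omega> \<Longrightarrow> s \<le> t \<Longrightarrow> t \<le> T \<Longrightarrow> - b \<le> D t x"
    and init: "\<And>x. (s, x) \<in> \<Omega> \<Longrightarrow> 0 \<le> D s x"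
    and super: "\<And>t x. (t, x) \<in> \<Omega> \<Longrightarrow> s < t \<Longrightarrow> t \<le> T \<Longrightarrow> D t x < 0 \<Longrightarrow>
       \<exists>N E r. open N \<and> (t, x) \<in> N \<and> N \<subseteq> \<Omega> \<and> (\<forall>(t', x') \<in> N. D t' x' \<le> E t' x') \<and>
         E t x = D t x \<and> heat_op E t x r \<and> \<Lambda> * D t x \<le> r"
    and tx: "(t, x) \<in> \<Omega>" "s \<le> t" "t \<le> T"
  shows "0 \<le> D t x"
proof (rule ccontr)
  assume "\<not> 0 \<le> D t x"
  then have neg: "D t x < 0" by simp
  define B where "B = exp (\<bar>\<Lambda>\<bar> * (T - s)) * (\<bar>b\<bar> + 1)"
  have "B > 0" by (auto simp: B_def intro!: mult_pos_pos)
  define F where "F = (\<lambda>\<epsilon> t x. exp (- \<Lambda> * (t - s)) * D t x + \<epsilon> * (x\<^sup>2 + 3 * (t - s)))"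
  define \<epsilon> where "\<epsilon> = exp (- \<Lambda> * (t - s)) * (- D t x) / (2 * (x\<^sup>2 + 3 * (t - s) + 1))"
  have den: "x\<^sup>2 + 3 * (t - s) + 1 > 0" using tx(2) by (intro add_nonneg_pos add_nonneg_nonneg) auto
  have eps: "\<epsilon> > 0" unfolding \<epsilon>_def using neg den by (intro divide_pos_pos mult_pos_pos) auto
  have Fneg: "F \<epsilon> t x < 0"
  proof -
    have "2 * \<epsilon> * (x\<^sup>2 + 3 * (t - s) + 1) = exp (- \<Lambda> * (t - s)) * (- D t x)"
      unfolding \<epsilon>_def using den by (simp add: field_simps)
    moreover have "0 < \<epsilon> * (x\<^sup>2 + 3 * (t - s) + 1)" using eps den by simp
    ultimately show ?thesis using eps by (simp add: F_def algebra_simps)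
  qed
  \<comment> \<open>beyond \<open>R\<close> the quadratic term outweighs the lower bound of \<open>D\<close>\<close>
  define R where "R = sqrt (B / \<epsilon>)"
  have far: "0 \<le> F \<epsilon> t' y" if "(t', y) \<in> \<Omega>" "s \<le> t'" "t' \<le> T" "\<bar>y\<bar> > R" for t' y
  proof -
    have "B / \<epsilon> \<le> \<bar>y\<bar>\<^sup>2" using that(4) by (intro sqrt_le_D) (simp add: R_def)
    then have 1: "B \<le> \<epsilon> * y\<^sup>2" using eps by (simp add: field_simps)
    have "exp (- \<Lambda> * (t' - s)) \<le> exp (\<bar>\<Lambda>\<bar> * (T - s))"
    proof -
      have "- \<Lambda> * (t' - s) \<le> \<bar>\<Lambda>\<bar> * (t' - s)" using that by (intro mult_right_mono) auto
      also have "\<dots> \<le> \<bar>\<Lambda>\<bar> * (T - s)" using that by (intro mult_left_mono) auto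
      finally show ?thesis by simp
    qed
    moreover define e\<^sub>1 where "e\<^sub>1 = exp (- \<Lambda> * (t' - s))"
    ultimately have "e\<^sub>1 * (\<bar>b\<bar> + 1) \<le> B"
      unfolding B_def by (intro mult_right_mono) auto
    moreover have "e\<^sub>1 * - (\<bar>b\<bar> + 1) \<le> e\<^sub>1 * D t' y"
      using lb[OF that(1-3)] by (intro mult_left_mono) (auto simp: e\<^sub>1_def)
    moreover have "0 \<le> \<epsilon> * (3 * (t' - s))" using eps that(2) by simp
    ultimately show ?thesis
      using 1 unfolding F_def e\<^sub>1_def[symmetric] distrib_left mult_minus_right by linarith
  qed
  define K where "K = \<Omega> \<inter> ({s..T} \<times> {-R..R})"
  have "compact K" unfolding K_def using cl by (intro closed_Int_compact compact_Times) auto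
  moreover have "(t, x) \<in> K" using far[of t x] Fneg tx by (force simp: K_def)
  moreover have "continuous_on K (\<lambda>p. F \<epsilon> (fst p) (snd p))"
  proof -
    have "continuous_on K (\<lambda>p. D (fst p) (snd p))"
      using continuous_on_subset[OF cont, of K] by (auto simp: K_def case_prod_beta)
    then show ?thesis unfolding F_def by (intro continuous_intros)
  qed
  ultimately obtain p where p: "p \<in> K" "\<And>p'. p' \<in> K \<Longrightarrow> F \<epsilon> (fst p) (snd p) \<le> F \<epsilon> (fst p') (snd p')"
    using continuous_attains_inf[of K] by blast
  obtain t0 x0 where p0: "p = (t0, x0)" by force
  have t0: "(t0, x0) \<in> \<Omega>" "s \<le> t0" "t0 \<le> T" using p(1) by (auto simp: p0 K_def)
  have F0: "F \<epsilon> t0 x0 < 0" using p(2)[OF \<open>(t, x) \<in> K\<close>] Fneg by (simp add: p0)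
  have min: "F \<epsilon> t0 x0 \<le> F \<epsilon> t' y" if "(t', y) \<in> \<Omega>" "s \<le> t'" "t' \<le> T" for t' y
    using far[OF that] p(2)[of "(t', y)"] F0 that unfolding p0 K_def by force
  have D0: "D t0 x0 < 0"
  proof (rule ccontr)
    assume "\<not> D t0 x0 < 0"
    then have "0 \<le> F \<epsilon> t0 x0" unfolding F_def using eps t0 by auto
    with F0 show False by simp
  qed
  then have "s < t0" using init[of x0] t0 by (cases "s = t0") auto
  obtain N E r where NEr: "open N \<and> (t0, x0) \<in> N \<and> N \<subseteq> \<Omega> \<and>
      (\<forall>(t', x') \<in> N. D t' x' \<le> E t' x') \<and> E t0 x0 = D t0 x0 \<and>
      heat_op E t0 x0 r \<and> \<Lambda> * D t0 x0 \<le> r"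
    using super[OF t0(1) \<open>s < t0\<close> t0(3) D0] by (elim exE)
  then have N: "open N" "(t0, x0) \<in> N" "N \<subseteq> \<Omega>"
    and E: "\<And>t' x'. (t', x') \<in> N \<Longrightarrow> D t' x' \<le> E t' x'" "E t0 x0 = D t0 x0"
    and r: "heat_op E t0 x0 r" "\<Lambda> * D t0 x0 \<le> r"
    by auto
  obtain dt dx dxx where dE: "((\<lambda>s. E s x0) has_real_derivative dt) (at t0)"
    "\<And>y. (E t0 has_real_derivative dx y) (at y)" "(dx has_real_derivative dxx) (at x0)"
    "r = dt - dxx" using r(1) unfolding heat_op_def by blast
  define G where "G = (\<lambda>t x. exp (- \<Lambda> * (t - s)) * E t x + \<epsilon> * (x\<^sup>2 + 3 * (t - s)))"
  define e where "e = exp (- \<Lambda> * (t0 - s))"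
  have e: "e > 0" by (simp add: e_def)
  obtain d where d: "d > 0" "\<And>t' x'. \<bar>t' - t0\<bar> < d \<Longrightarrow> \<bar>x' - x0\<bar> < d \<Longrightarrow> (t', x') \<in> N"
  proof -
    obtain S S' where S': "open S" "open S'" "(t0, x0) \<in> S \<times> S'" "S \<times> S' \<subseteq> N"
      by (rule open_prod_elim[OF N(1,2)])
    then have S: "t0 \<in> S" "x0 \<in> S'" by auto
    obtain d1 where d1: "d1 > 0" "ball t0 d1 \<subseteq> S" using openE[OF S'(1) S(1)] by metis
    obtain d2 where d2: "d2 > 0" "ball x0 d2 \<subseteq> S'" using openE[OF S'(2) S(2)] by metis
    show ?thesis
    proof (rule that[of "min d1 d2"])
      fix t' x' assume "\<bar>t' - t0\<bar> < min d1 d2" "\<bar>x' - x0\<bar> < min d1 d2"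
      then have "t' \<in> S" "x' \<in> S'" using d1(2) d2(2) by (auto simp: subset_iff dist_real_def abs_minus_commute)
      then show "(t', x') \<in> N" using S'(4) by auto
    qed (use d1(1) d2(1) in auto)
  qed
  have GF: "G t0 x0 \<le> G t' x'" if "\<bar>t' - t0\<bar> < d" "\<bar>x' - x0\<bar> < d" "s \<le> t'" "t' \<le> T" for t' x'
  proof -
    have "(t', x') \<in> N" using d(2) that by simp
    then have "F \<epsilon> t' x' \<le> G t' x'" using E(1) by (auto simp: F_def G_def)
    moreover have "G t0 x0 = F \<epsilon> t0 x0" by (simp add: F_def G_def E(2))
    moreover have "F \<epsilon> t0 x0 \<le> F \<epsilon> t' x'" using \<open>(t', x') \<in> N\<close> N(3) that by (intro min) auto
    ultimately show ?thesis by simp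
  qed
  have "0 \<le> e * dxx + 2 * \<epsilon>"
  proof (rule second_derivative_nonneg_at_local_min[OF _ _ d(1)])
    show "(G t0 has_real_derivative e * dx y + 2 * \<epsilon> * y) (at y)" for y
      unfolding G_def e_def by (auto intro!: derivative_eq_intros dE(2))
    show "((\<lambda>y. e * dx y + 2 * \<epsilon> * y) has_real_derivative e * dxx + 2 * \<epsilon>) (at x0)"
      by (auto intro!: derivative_eq_intros dE(3))
    show "G t0 x0 \<le> G t0 y" if "\<bar>x0 - y\<bar> < d" for y
      using GF[of t0 y] that d(1) t0 by (simp add: abs_minus_commute)
  qed
  moreover have "e * (dt - \<Lambda> * E t0 x0) + 3 * \<epsilon> \<le> 0"
  proof (rule ccontr)
    assume *: "\<not> ?thesis"
    have "((\<lambda>t. G t x0) has_real_derivative e * (dt - \<Lambda> * E t0 x0) + 3 * \<epsilon>) (at t0)"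
      unfolding G_def e_def
      by (auto intro!: derivative_eq_intros dE(1) simp: algebra_simps)
    then obtain d' where d': "d' > 0" "\<And>h. h > 0 \<Longrightarrow> h < d' \<Longrightarrow> G (t0 - h) x0 < G t0 x0"
      using DERIV_pos_inc_left * by (metis not_le)
    \<comment> \<open>a backward step in time that stays in \<open>N\<close> and after the initial time\<close>
    define h where "h = min (min d d') (t0 - s) / 2"
    have "h > 0" "h < d" "h < d'" "h < t0 - s" using d(1) d'(1) \<open>s < t0\<close> by (auto simp: h_def min_def)
    then show False using GF[of "t0 - h" x0] d' t0 by force
  qed
  moreover have "e * (\<Lambda> * D t0 x0) \<le> e * r" using r(2) e by (intro mult_left_mono) auto
  ultimately have "3 * \<epsilon> \<le> 2 * \<epsilon>" unfolding dE(4) E(2) by (simp add: algebra_simps)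
  with eps show False by simp
qed

lemma parabolic_comparison:
  fixes D :: "real \<Rightarrow> real \<Rightarrow> real"
  assumes cl: "closed \<Omega>"
    and cont: "continuous_on (\<Omega> \<inter> {s..T} \<times> UNIV) (\<lambda>(t, x). D t x)"
    and lb: "\<And>t x. (t, x) \<in> \<Omega> \<Longrightarrow> s \<le> t \<Longrightarrow> t \<le> T \<Longrightarrow> - b \<le> D t x"
    and init: "\<And>x. (s, x) \<in> \<Omega> \<Longrightarrow> 0 \<le> D s x"
    and super: "\<And>t x. (t, x) \<in> \<Omega> \<Longrightarrow> s < t \<Longrightarrow> t \<le> T \<Longrightarrow> D t x < 0 \<Longrightarrow>
       (t, x) \<in> interior \<Omega> \<and> (\<exists>r. heat_op D t x r \<and> \<Lambda> * D t x \<le> r)"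
    and tx: "(t, x) \<in> \<Omega>" "s \<le> t" "t \<le> T"
  shows "0 \<le> D t x"
proof (rule parabolic_comparison_test[where D = D and t = t and x = x and \<Lambda> = \<Lambda> and \<Omega> = \<Omega> and s = s and T = T and b = b])
  show "\<exists>N E r. open N \<and> (t, x) \<in> N \<and> N \<subseteq> \<Omega> \<and> (\<forall>(t', x') \<in> N. D t' x' \<le> E t' x') \<and>
         E t x = D t x \<and> heat_op E t x r \<and> \<Lambda> * D t x \<le> r"
    if "(t, x) \<in> \<Omega>" "s < t" "t \<le> T" "D t x < 0" for t x
    using super[OF that] by (intro exI[of _ "interior \<Omega>"] exI[of _ D]) (auto simp: interior_subset)
qed (use assms in auto)

section \<open>Spreading speed and exponential tails\<close>

lemma heat_op_exp: "heat_op (\<lambda>t x. exp (k * x + p * t + q)) t x ((p - k\<^sup>2) * exp (k * x + p * t + q))"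
proof (rule heat_opI)
  show "((\<lambda>s. exp (k * x + p * s + q)) has_real_derivative p * exp (k * x + p * t + q)) (at t)"
    by (auto intro!: derivative_eq_intros)
  show "((\<lambda>x. exp (k * x + p * t + q)) has_real_derivative k * exp (k * y + p * t + q)) (at y)" for y
    by (auto intro!: derivative_eq_intros)
  show "((\<lambda>x. k * exp (k * x + p * t + q)) has_real_derivative k * (k * exp (k * x + p * t + q))) (at x)"
    by (auto intro!: derivative_eq_intros)
qed (simp add: algebra_simps power2_eq_square)

lemma exp_decay_backwards:
  fixes k \<epsilon> T A T' :: real
  assumes "k > 0" and "\<epsilon> > 0"
  shows "\<forall>\<^sub>F s in at_bot. exp (A - k * (T - s)) < \<epsilon> \<and> s \<le> T'"
proof -
  have "((\<lambda>s. exp (A - k * (T - s))) \<longlongrightarrow> 0) at_bot" using assms(1) by real_asymp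
  then have "\<forall>\<^sub>F s in at_bot. exp (A - k * (T - s)) < \<epsilon>" using assms(2) by (rule order_tendstoD)
  then show ?thesis by (intro eventually_conj eventually_le_at_bot)
qed

text \<open>The two uniform limits, packed into one distance \<open>M\<close> for a prescribed accuracy.\<close>
lemma interface_bounds:
  assumes "interface_location u \<xi>" and "\<delta> > 0"
  shows "\<exists>M>0. \<forall>t y. (y \<le> - M \<longrightarrow> 1 - \<delta> < u t (y + \<xi> t)) \<and> (M \<le> y \<longrightarrow> u t (y + \<xi> t) < \<delta>)"
proof -
  have "\<forall>\<^sub>F x in at_bot. \<forall>t\<in>UNIV. dist (u t (x + \<xi> t)) 1 < \<delta>"
    using assms unfolding interface_location_def by (auto dest: uniform_limitD)
  then obtain A where A: "\<And>x t. x \<le> A \<Longrightarrow> dist (u t (x + \<xi> t)) 1 < \<delta>"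
    unfolding eventually_at_bot_linorder by auto
  have "\<forall>\<^sub>F x in at_top. \<forall>t\<in>UNIV. dist (u t (x + \<xi> t)) 0 < \<delta>"
    using assms unfolding interface_location_def by (auto dest: uniform_limitD)
  then obtain B where B: "\<And>x t. x \<ge> B \<Longrightarrow> dist (u t (x + \<xi> t)) 0 < \<delta>"
    unfolding eventually_at_top_linorder by auto
  show ?thesis
  proof (intro exI[of _ "\<bar>A\<bar> + \<bar>B\<bar> + 1"] conjI allI impI)
    fix t y
    show "1 - \<delta> < u t (y + \<xi> t)" if "y \<le> - (\<bar>A\<bar> + \<bar>B\<bar> + 1)"
      using A[of y t] that unfolding dist_real_def by argo
    show "u t (y + \<xi> t) < \<delta>" if "\<bar>A\<bar> + \<bar>B\<bar> + 1 \<le> y"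
      using B[of y t] that unfolding dist_real_def by argo
  qed auto
qed

text \<open>What the argument needs from the nonlinearity: no reaction below \<open>\<theta>\<close>, a uniform decay rate \<open>\<beta>\<close> of
  differences above \<open>\<theta>'\<close>, a uniform Lipschitz constant near \<open>[0, 1]\<close>, and in between a reaction that is
  bounded away from zero uniformly in time. The Lipschitz interval exceeds \<open>[0, 1]\<close> because
  comparison functions overshoot it slightly.\<close>
locale ignition =
  fixes f :: "real \<Rightarrow> real \<Rightarrow> real" and \<theta> \<theta>' \<beta> L :: real
  assumes theta: "0 < \<theta>" "\<theta> < \<theta>'" "\<theta>' < 1"
    and beta_pos: "0 < \<beta>" and L_pos: "0 < L"
    and f_zero: "u \<le> \<theta> \<Longrightarrow> f t u = 0"
    and f_nonneg: "u \<le> 1 \<Longrightarrow> 0 \<le> f t u"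
    and f_lipschitz: "u \<in> {-1..2} \<Longrightarrow> v \<in> {-1..2} \<Longrightarrow> \<bar>f t u - f t v\<bar> \<le> L * \<bar>u - v\<bar>"
    and f_stable: "\<theta>' \<le> u \<Longrightarrow> u \<le> v \<Longrightarrow> f t v \<le> f t u - \<beta> * (v - u)"
    and f_pos: "\<theta> < a \<Longrightarrow> b < 1 \<Longrightarrow> \<exists>m>0. \<forall>t. \<forall>u\<in>{a..b}. m \<le> f t u"
begin

text \<open>The parts of being an entire classical solution that a comparison argument sees. The class is
  closed under translation and reflection in space.\<close>
definition solution :: "(real \<Rightarrow> real \<Rightarrow> real) \<Rightarrow> bool" where
  "solution v \<longleftrightarrow> continuous_on UNIV (\<lambda>(t, x). v t x) \<and>
     (\<forall>t x. 0 < v t x \<and> v t x < 1 \<and> heat_op v t x (f t (v t x)))"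

lemma solution_continuous:
  assumes "solution v" and "continuous_on S g" and "continuous_on S h"
  shows "continuous_on S (\<lambda>p. v (g p) (h p))"
proof -
  have "continuous_on UNIV (\<lambda>(t, x). v t x)" using assms(1) by (simp add: solution_def)
  from continuous_on_compose2[OF this continuous_on_Pair[OF assms(2,3)]] show ?thesis by simp
qed

lemma solution_range: "solution v \<Longrightarrow> 0 < v t x" "solution v \<Longrightarrow> v t x < 1"
  by (simp_all add: solution_def)

lemma solution_heat_op: "solution v \<Longrightarrow> heat_op v t x (f t (v t x))"
  by (simp add: solution_def)

lemma solution_affine_space:
  assumes v: "solution v" and s: "\<sigma> = 1 \<or> \<sigma> = -1"
  shows "solution (\<lambda>t x. v t (a + \<sigma> * x))"
  unfolding solution_def case_prod_beta
proof (intro conjI allI)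
  show "continuous_on UNIV (\<lambda>p. v (fst p) (a + \<sigma> * snd p))"
    by (intro solution_continuous[OF v] continuous_intros)
  show "heat_op (\<lambda>t x. v t (a + \<sigma> * x)) t x (f t (v t (a + \<sigma> * x)))" for t x
    by (intro heat_op_affine_space solution_heat_op v s)
qed (use solution_range[OF v] in auto)

lemma solution_translate: "solution v \<Longrightarrow> solution (\<lambda>t x. v t (x + a))"
  using solution_affine_space[of v 1 a] by (simp add: add.commute)

lemma f_bounds: "0 \<le> u \<Longrightarrow> u \<le> 1 \<Longrightarrow> f t u \<le> L"
proof -
  assume u: "0 \<le> u" "u \<le> 1"
  have "\<bar>f t u - f t 0\<bar> \<le> L * \<bar>u - 0\<bar>" using u by (intro f_lipschitz) auto
  moreover have "f t 0 = 0" using theta by (intro f_zero) simp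
  moreover have "L * u \<le> L" using u L_pos by (intro mult_left_le) auto
  ultimately show "f t u \<le> L" using u by simp
qed

text \<open>The reaction pushes a plateau of height below \<open>1\<close> forward at some fixed speed \<open>c > 0\<close>: a
  travelling profile \<open>\<psi> (x - c t)\<close> is a subsolution. To the left of its corner it is
  \<open>a - d exp (\<kappa> y)\<close>, with values between \<open>\<theta>\<^sub>1 > \<theta>\<close> and \<open>a\<close>, where the reaction is at least \<open>m\<close> and pays for
  the concavity once \<open>c\<close> is small. To the right it is the travelling heat solution
  \<open>(\<theta>\<^sub>1 + 1) exp (- c y) - 1\<close>, which dives below zero and so starts below every positive solution. The
  speed depends on the nonlinearity alone; only the constant \<open>K\<close> depends on the wave.\<close>
lemma front_speed_positive:
  "\<exists>c>0. \<forall>v \<eta>. solution v \<longrightarrow> interface_location v \<eta> \<longrightarrow>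
     (\<exists>K. \<forall>s t. s \<le> t \<longrightarrow> \<eta> s + c * (t - s) - K \<le> \<eta> t)"
proof -
  define \<theta>\<^sub>1 where "\<theta>\<^sub>1 = (2 * \<theta> + 1) / 3"
  define a where "a = (\<theta> + 2) / 3"
  define d where "d = a - \<theta>\<^sub>1"
  have ord: "\<theta> < \<theta>\<^sub>1" "\<theta>\<^sub>1 < a" "a < 1" "0 < \<theta>\<^sub>1" "0 < d"
    using theta by (auto simp: \<theta>\<^sub>1_def a_def d_def)
  obtain m where m: "m > 0" "\<And>t u. \<theta>\<^sub>1 \<le> u \<Longrightarrow> u \<le> a \<Longrightarrow> m \<le> f t u"
    using f_pos[OF ord(1,3)] by auto
  \<comment> \<open>\<open>c\<^sup>2 A\<close> is the largest value of \<open>\<psi>\<^sub>t - \<psi>\<^sub>x\<^sub>x\<close> left of the corner, attained at \<open>y = 0\<close>\<close>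
  define A where "A = (\<theta>\<^sub>1 + 1) * (1 + (\<theta>\<^sub>1 + 1) / d)"
  have A: "A > 0" unfolding A_def using ord by (auto intro!: mult_pos_pos add_pos_pos)
  define c where "c = sqrt (m / A)"
  have c: "c > 0" "c\<^sup>2 * A = m" using m(1) A by (auto simp: c_def)
  define \<kappa> where "\<kappa> = c * (\<theta>\<^sub>1 + 1) / d"
  have \<kappa>: "\<kappa> > 0" "\<kappa> * d = c * (\<theta>\<^sub>1 + 1)" using c ord by (auto simp: \<kappa>_def)
  have \<kappa>m: "d * (\<kappa> * c + \<kappa>\<^sup>2) = m"
  proof -
    have "d * (\<kappa> * c + \<kappa>\<^sup>2) = (\<kappa> * d) * c + (\<kappa> * d) * \<kappa>" by (simp add: algebra_simps power2_eq_square)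
    also have "\<dots> = c\<^sup>2 * A"
      unfolding \<kappa>(2) unfolding A_def \<kappa>_def by (simp add: algebra_simps power2_eq_square)
    finally show ?thesis using c(2) by simp
  qed
  \<comment> \<open>the point where the right branch vanishes\<close>
  define Y where "Y = ln (\<theta>\<^sub>1 + 1) / c"
  have Y: "Y > 0" "c * Y = ln (\<theta>\<^sub>1 + 1)" using c ord by (auto simp: Y_def)
  define \<psi>\<^sub>1 where "\<psi>\<^sub>1 = (\<lambda>y. a - d * exp (\<kappa> * y))"
  define \<psi>\<^sub>2 where "\<psi>\<^sub>2 = (\<lambda>y. (\<theta>\<^sub>1 + 1) * exp (- c * y) - 1)"
  define \<psi> where "\<psi> = (\<lambda>y. \<psi>\<^sub>1 (min y 0) + \<psi>\<^sub>2 (max y 0) - \<theta>\<^sub>1)"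
  have \<psi>_le: "y \<le> 0 \<Longrightarrow> \<psi> y = \<psi>\<^sub>1 y" for y
    by (simp add: \<psi>_def \<psi>\<^sub>2_def)
  have \<psi>_ge: "0 \<le> y \<Longrightarrow> \<psi> y = \<psi>\<^sub>2 y" for y
    by (simp add: \<psi>_def \<psi>\<^sub>1_def d_def)
  \<comment> \<open>convexity of \<open>exp\<close>: the corner is convex, so \<open>\<psi>\<close> is locally a maximum and \<open>\<psi>\<^sub>1\<close> may serve as test function there\<close>
  have \<psi>12: "\<psi>\<^sub>1 y \<le> \<psi> y" for y
  proof (cases "y \<le> 0")
    case False
    have "d * (1 + \<kappa> * y) \<le> d * exp (\<kappa> * y)" using ord by (intro mult_left_mono) auto
    moreover have "(\<theta>\<^sub>1 + 1) * (1 - c * y) \<le> (\<theta>\<^sub>1 + 1) * exp (- c * y)"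
      using ord exp_ge_add_one_self[of "- c * y"] by (intro mult_left_mono) auto
    moreover have "d * (1 + \<kappa> * y) = d + c * (\<theta>\<^sub>1 + 1) * y"
      using \<kappa>(2) by (metis distrib_left mult.assoc mult.commute mult.right_neutral)
    ultimately show ?thesis using False unfolding \<psi>_ge[OF less_imp_le[OF False[unfolded not_le]]]
      by (simp add: \<psi>\<^sub>1_def \<psi>\<^sub>2_def d_def algebra_simps)
  qed (simp add: \<psi>_le)
  have \<psi>1_bound: "\<theta>\<^sub>1 \<le> \<psi>\<^sub>1 y" "\<psi>\<^sub>1 y \<le> a" if "y \<le> 0" for y
  proof -
    have "exp (\<kappa> * y) \<le> 1" using that \<kappa>(1) by (simp add: mult_le_0_iff)
    then have "d * exp (\<kappa> * y) \<le> d" using ord by (intro mult_left_le) auto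
    then show "\<theta>\<^sub>1 \<le> \<psi>\<^sub>1 y" by (simp add: \<psi>\<^sub>1_def d_def)
    show "\<psi>\<^sub>1 y \<le> a" using ord by (simp add: \<psi>\<^sub>1_def)
  qed
  have \<psi>2_bound: "0 \<le> y \<Longrightarrow> \<psi>\<^sub>2 y \<le> \<theta>\<^sub>1" "Y \<le> y \<Longrightarrow> \<psi>\<^sub>2 y \<le> 0" for y
  proof -
    show "\<psi>\<^sub>2 y \<le> \<theta>\<^sub>1" if "0 \<le> y"
    proof -
      have "exp (- c * y) \<le> 1" using that c(1) by simp
      then have "(\<theta>\<^sub>1 + 1) * exp (- c * y) \<le> \<theta>\<^sub>1 + 1" using ord by (intro mult_left_le) auto
      then show ?thesis by (simp add: \<psi>\<^sub>2_def)
    qed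
    assume "Y \<le> y"
    then have "exp (- c * y) \<le> exp (- ln (\<theta>\<^sub>1 + 1))" using c(1) Y(2) by (simp flip: Y(2))
    also have "\<dots> = 1 / (\<theta>\<^sub>1 + 1)" using ord by (simp add: exp_minus field_simps)
    finally show "\<psi>\<^sub>2 y \<le> 0" using ord by (simp add: \<psi>\<^sub>2_def field_simps)
  qed
  have \<psi>_bound: "\<psi> y \<le> a" for y
    using \<psi>1_bound(2)[of y] \<psi>2_bound(1)[of y] \<psi>_le[of y] \<psi>_ge[of y] ord by (cases "y \<le> 0") auto
  show ?thesis
  proof (rule exI[of _ c], intro conjI allI impI c)
    fix v \<eta> assume v: "solution v" and \<eta>: "interface_location v \<eta>"
    obtain M where M: "M > 0" "\<And>t y. y \<le> - M \<Longrightarrow> a \<le> v t (y + \<eta> t)"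
      "\<And>t y. M \<le> y \<Longrightarrow> v t (y + \<eta> t) < \<theta>\<^sub>1"
    proof -
      define \<delta> where "\<delta> = min (1 - a) \<theta>\<^sub>1"
      have \<delta>: "\<delta> > 0" "\<delta> \<le> 1 - a" "\<delta> \<le> \<theta>\<^sub>1" using ord by (auto simp: \<delta>_def)
      obtain M where M: "M > 0" "\<forall>t y. (y \<le> - M \<longrightarrow> 1 - \<delta> < v t (y + \<eta> t)) \<and> (M \<le> y \<longrightarrow> v t (y + \<eta> t) < \<delta>)"
        using interface_bounds[OF \<eta> \<delta>(1)] by blast
      show ?thesis
      proof (rule that[OF M(1)])
        fix t y
        show "a \<le> v t (y + \<eta> t)" if "y \<le> - M" using M(2)[rule_format, of y t] that \<delta> by linarith
        show "v t (y + \<eta> t) < \<theta>\<^sub>1" if "M \<le> y" using M(2)[rule_format, of y t] that \<delta> by linarith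
      qed
    qed
    show "\<exists>K. \<forall>s t. s \<le> t \<longrightarrow> \<eta> s + c * (t - s) - K \<le> \<eta> t"
    proof (intro exI[of _ "2 * M + Y"] allI impI)
      fix s t :: real assume "s \<le> t"
      define x\<^sub>0 where "x\<^sub>0 = \<eta> s - M - Y"
      define y where "y = (\<lambda>t x. x - x\<^sub>0 - c * (t - s))"
      define D where "D = (\<lambda>t x. v t x - \<psi> (y t x))"
      have cont: "continuous_on UNIV (\<lambda>(t, x). D t x)"
        unfolding case_prod_beta D_def \<psi>_def \<psi>\<^sub>1_def \<psi>\<^sub>2_def y_def
        by (intro continuous_intros solution_continuous[OF v])
      have "0 \<le> D t (x\<^sub>0 + c * (t - s))"
      proof (rule parabolic_comparison_test[where D = D and t = t and x = "x\<^sub>0 + c * (t - s)"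
            and \<Omega> = UNIV and s = s and T = t and b = a and \<Lambda> = L])
        show "continuous_on (UNIV \<inter> {s..t} \<times> UNIV) (\<lambda>(t, x). D t x)"
          using cont continuous_on_subset by blast
        show "- a \<le> D t x" for t x
          using \<psi>_bound[of "y t x"] solution_range[OF v, of t x] by (simp add: D_def)
        show "0 \<le> D s x" for x
        proof (cases "x \<le> \<eta> s - M")
          case True
          then show ?thesis using M(2)[of "x - \<eta> s" s] \<psi>_bound[of "y s x"] by (simp add: D_def)
        next
          case False
          then have "Y \<le> y s x" by (simp add: y_def x\<^sub>0_def)
          then show ?thesis using \<psi>2_bound(2)[of "y s x"] \<psi>_ge[of "y s x"] Y(1) solution_range[OF v, of s x]
            by (simp add: D_def)
        qed
        fix t x assume Dneg: "D t x < 0"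
        show "\<exists>N E r. open N \<and> (t, x) \<in> N \<and> N \<subseteq> UNIV \<and> (\<forall>(t', x') \<in> N. D t' x' \<le> E t' x') \<and>
         E t x = D t x \<and> heat_op E t x r \<and> L * D t x \<le> r"
        proof (cases "y t x \<le> 0")
          case True
          have "heat_op (\<lambda>t x. v t x - \<psi>\<^sub>1 (y t x)) t x (f t (v t x) - d * (\<kappa> * c + \<kappa>\<^sup>2) * exp (\<kappa> * y t x))"
          proof -
            have "heat_op (\<lambda>t x. v t x - (a - d * exp (\<kappa> * x + (- \<kappa> * c) * t + \<kappa> * (c * s - x\<^sub>0)))) t x
              (f t (v t x) - (0 - d * ((- \<kappa> * c - \<kappa>\<^sup>2) * exp (\<kappa> * x + (- \<kappa> * c) * t + \<kappa> * (c * s - x\<^sub>0)))))"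
              by (intro heat_op_diff heat_op_cmult heat_op_const heat_op_exp solution_heat_op v)
            moreover have exponent: "\<kappa> * x + (- \<kappa> * c) * t + \<kappa> * (c * s - x\<^sub>0) = \<kappa> * y t x" for t x
              by (simp add: y_def algebra_simps)
            ultimately show ?thesis
              unfolding exponent by (simp add: \<psi>\<^sub>1_def algebra_simps)
          qed
          moreover have "L * D t x \<le> f t (v t x) - d * (\<kappa> * c + \<kappa>\<^sup>2) * exp (\<kappa> * y t x)"
          proof -
            have "m * exp (\<kappa> * y t x) \<le> m"
              using True \<kappa>(1) m(1) by (intro mult_left_le) (auto simp: mult_le_0_iff)
            also have "\<dots> \<le> f t (\<psi> (y t x))" using m(2) \<psi>1_bound[OF True] \<psi>_le[OF True] by simp
            finally have "m * exp (\<kappa> * y t x) \<le> f t (\<psi> (y t x))" .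
            moreover have "\<bar>f t (v t x) - f t (\<psi> (y t x))\<bar> \<le> L * \<bar>D t x\<bar>"
              unfolding D_def using solution_range[OF v, of t x] \<psi>1_bound[OF True] \<psi>_le[OF True] ord
              by (intro f_lipschitz) auto
            ultimately show ?thesis using Dneg unfolding \<kappa>m by auto
          qed
          moreover have "D t' x' \<le> v t' x' - \<psi>\<^sub>1 (y t' x')" for t' x'
            using \<psi>12 by (simp add: D_def)
          ultimately show ?thesis
            by (intro exI[of _ UNIV] exI[of _ "\<lambda>t x. v t x - \<psi>\<^sub>1 (y t x)"])
              (auto simp: D_def \<psi>_le[OF True])
        next
          case False
          have "heat_op (\<lambda>t x. v t x - \<psi>\<^sub>2 (y t x)) t x (f t (v t x))"
          proof -
            have "heat_op (\<lambda>t x. v t x - ((\<theta>\<^sub>1 + 1) * exp ((- c) * x + c\<^sup>2 * t + c * (x\<^sub>0 - c * s)) - 1)) t x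
              (f t (v t x) - ((\<theta>\<^sub>1 + 1) * ((c\<^sup>2 - (- c)\<^sup>2) * exp ((- c) * x + c\<^sup>2 * t + c * (x\<^sub>0 - c * s))) - 0))"
              by (intro heat_op_diff heat_op_cmult heat_op_const heat_op_exp solution_heat_op v)
            moreover have exponent: "(- c) * x + c\<^sup>2 * t + c * (x\<^sub>0 - c * s) = - c * y t x" for t x
              by (simp add: y_def algebra_simps power2_eq_square)
            ultimately show ?thesis unfolding exponent by (simp add: \<psi>\<^sub>2_def)
          qed
          moreover have "L * D t x \<le> f t (v t x)"
            using mult_pos_neg[OF L_pos Dneg] f_nonneg[of "v t x" t] solution_range[OF v, of t x]
            by linarith
          moreover have "open {p. 0 < y (fst p) (snd p)}"
            unfolding y_def by (intro open_Collect_less continuous_intros)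
          ultimately show ?thesis using False
            by (intro exI[of _ "{p. 0 < y (fst p) (snd p)}"] exI[of _ "\<lambda>t x. v t x - \<psi>\<^sub>2 (y t x)"])
              (auto simp: D_def \<psi>_ge)
        qed
      qed (use \<open>s \<le> t\<close> in auto)
      then have "\<theta>\<^sub>1 \<le> v t (x\<^sub>0 + c * (t - s))"
        by (simp add: D_def y_def \<psi>_le \<psi>\<^sub>1_def d_def)
      then have "x\<^sub>0 + c * (t - s) - \<eta> t < M" using M(3)[of "x\<^sub>0 + c * (t - s) - \<eta> t" t] by (metis diff_add_cancel not_le)
      then show "\<eta> s + c * (t - s) - (2 * M + Y) \<le> \<eta> t" by (simp add: x\<^sub>0_def)
    qed
  qed
qed

text \<open>A wave whose front moves at average speed at least \<open>c\<close> decays at rate \<open>c\<close> ahead of it. Looking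
  backwards from a time \<open>T\<close>, the front stays behind a line \<open>l\<close> of slope \<open>c\<close>, and ahead of the
  line the wave is below \<open>\<theta>\<close> and solves the heat equation. The barrier is the travelling exponential attached
  to \<open>l\<close>, plus the accuracy \<open>\<epsilon>\<close> of the wave's limit, plus an exponential travelling at the smaller
  speed \<open>\<alpha>\<close> that dominates the wave at the initial time \<open>s0\<close>. The line outruns the last term, so
  that it vanishes as \<open>s0\<close> goes to minus infinity.\<close>
lemma wave_tail:
  assumes v: "solution v" and \<eta>: "interface_location v \<eta>" and c: "c > 0"
    and speed: "\<And>s t. s \<le> t \<Longrightarrow> \<eta> s + c * (t - s) - K \<le> \<eta> t"
  shows "\<exists>C>0. \<forall>t x. v t x \<le> C * exp (- c * (x - \<eta> t))"
proof -
  obtain M where M: "M > 0" "\<And>t y. M \<le> y \<Longrightarrow> v t (y + \<eta> t) < \<theta>"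
    using interface_bounds[OF \<eta>, of \<theta>] theta by auto
  have *: "v T x \<le> exp (- c * (x - (\<eta> T + K + M)))" if x: "\<eta> T + K + M \<le> x" for T x
  proof (rule field_le_epsilon)
    fix e :: real assume "e > 0"
    define \<epsilon> where "\<epsilon> = e / 2"
    have "\<epsilon> > 0" using \<open>e > 0\<close> by (simp add: \<epsilon>_def)
    obtain M' where M': "M' > 0" "\<And>t y. M' \<le> y \<Longrightarrow> v t (y + \<eta> t) < \<epsilon>"
      using interface_bounds[OF \<eta> \<open>\<epsilon> > 0\<close>] by auto
    define \<alpha> where "\<alpha> = c / 2"
    define l where "l = (\<lambda>s. \<eta> T - c * (T - s) + K + M)"
    have l: "\<eta> s + M \<le> l s" if "s \<le> T" for s using speed[OF that] by (simp add: l_def)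
    have "\<alpha> * (c - \<alpha>) > 0" using c by (simp add: \<alpha>_def)
    then obtain s0 where s0: "exp (\<alpha> * M' - \<alpha> * (c - \<alpha>) * (T - s0)) < \<epsilon>" "s0 \<le> T"
      using eventually_happens[OF exp_decay_backwards[OF \<open>\<alpha> * (c - \<alpha>) > 0\<close> \<open>\<epsilon> > 0\<close>]]
      by (meson trivial_limit_at_bot_linorder)
    define D where "D = (\<lambda>s y. exp ((- c) * y + c\<^sup>2 * s + c * (l s0 - c * s0)) + \<epsilon>
       + exp ((- \<alpha>) * y + \<alpha>\<^sup>2 * s + \<alpha> * (l s0 + M' - \<alpha> * s0)) - v s y)"
    have e1: "(- c) * y + c\<^sup>2 * s + c * (l s0 - c * s0) = - c * (y - l s)" for s y
      by (simp add: l_def algebra_simps power2_eq_square)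
    have "0 \<le> D T x"
    proof (rule parabolic_comparison[where D = D and \<Omega> = "{p. l (fst p) \<le> snd p}" and s = s0
          and T = T and b = 1 and \<Lambda> = 0 and t = T and x = x])
      show "closed {p. l (fst p) \<le> snd p}"
        unfolding l_def by (intro closed_Collect_le continuous_intros)
      show "continuous_on ({p. l (fst p) \<le> snd p} \<inter> {s0..T} \<times> UNIV) (\<lambda>(t, x). D t x)"
        unfolding case_prod_beta D_def by (intro continuous_intros solution_continuous[OF v])
      show "- 1 \<le> D s y" for s y
        using solution_range[OF v, of s y] \<open>\<epsilon> > 0\<close> 
          exp_gt_zero[of "- c * (y - l s)"] exp_gt_zero[of "(- \<alpha>) * y + \<alpha>\<^sup>2 * s + \<alpha> * (l s0 + M' - \<alpha> * s0)"] unfolding D_def e1 by linarith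
      show "0 \<le> D s0 y" if "(s0, y) \<in> {p. l (fst p) \<le> snd p}" for y
      proof (cases "\<eta> s0 + M' \<le> y")
        case True
        then have "v s0 y < \<epsilon>" using M'(2)[of "y - \<eta> s0" s0] by simp
        then show ?thesis using exp_gt_zero[of "- c * (y - l s0)"]
            exp_gt_zero[of "(- \<alpha>) * y + \<alpha>\<^sup>2 * s0 + \<alpha> * (l s0 + M' - \<alpha> * s0)"] unfolding D_def e1 by linarith
      next
        case False
        have "0 \<le> \<alpha> * (l s0 + M' - y)" using False l[OF s0(2)] M(1) c
          by (intro mult_nonneg_nonneg) (auto simp: \<alpha>_def)
        also have "\<dots> = (- \<alpha>) * y + \<alpha>\<^sup>2 * s0 + \<alpha> * (l s0 + M' - \<alpha> * s0)"
          by (simp add: algebra_simps power2_eq_square)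
        finally have "1 \<le> exp ((- \<alpha>) * y + \<alpha>\<^sup>2 * s0 + \<alpha> * (l s0 + M' - \<alpha> * s0))" by simp
        then show ?thesis using solution_range[OF v, of s0 y] \<open>\<epsilon> > 0\<close>
            exp_gt_zero[of "(- c) * y + c\<^sup>2 * s0 + c * (l s0 - c * s0)"] unfolding D_def by linarith
      qed
      show "(s, y) \<in> interior {p. l (fst p) \<le> snd p} \<and> (\<exists>r. heat_op D s y r \<and> 0 * D s y \<le> r)"
        if sy: "(s, y) \<in> {p. l (fst p) \<le> snd p}" "s \<le> T" "D s y < 0" for s y
      proof
        have "l s < y"
        proof (rule ccontr)
          assume "\<not> l s < y"
          then have "y = l s" using sy(1) by simp
          then have "1 + \<epsilon> - v s y \<le> D s y" unfolding D_def e1 by simp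
          then show False using sy(3) \<open>\<epsilon> > 0\<close> solution_range[OF v, of s y] by simp
        qed
        moreover have "{p. l (fst p) < snd p} \<subseteq> interior {p. l (fst p) \<le> snd p}"
          unfolding l_def by (intro interior_maximal open_Collect_less continuous_intros) auto
        ultimately show "(s, y) \<in> interior {p. l (fst p) \<le> snd p}" by auto
        have "v s y \<le> \<theta>" using M(2)[of "y - \<eta> s" s] l[OF sy(2)] \<open>l s < y\<close> by simp
        then have "f s (v s y) = 0" by (rule f_zero)
        moreover have "heat_op D s y ((c\<^sup>2 - (- c)\<^sup>2) * exp ((- c) * y + c\<^sup>2 * s + c * (l s0 - c * s0)) + 0
          + (\<alpha>\<^sup>2 - (- \<alpha>)\<^sup>2) * exp ((- \<alpha>) * y + \<alpha>\<^sup>2 * s + \<alpha> * (l s0 + M' - \<alpha> * s0)) - f s (v s y))"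
          unfolding D_def
          by (intro heat_op_diff heat_op_add heat_op_const heat_op_exp solution_heat_op v)
        ultimately show "\<exists>r. heat_op D s y r \<and> 0 * D s y \<le> r" by auto
      qed
    qed (use x s0 in \<open>auto simp: l_def\<close>)
    have "(- \<alpha>) * x + \<alpha>\<^sup>2 * T + \<alpha> * (l s0 + M' - \<alpha> * s0) \<le> \<alpha> * M' - \<alpha> * (c - \<alpha>) * (T - s0)"
    proof -
      have "(- \<alpha>) * x + \<alpha>\<^sup>2 * T + \<alpha> * (l s0 + M' - \<alpha> * s0) =
         \<alpha> * M' - \<alpha> * (c - \<alpha>) * (T - s0) - \<alpha> * (x - l T)"
        by (simp add: l_def algebra_simps power2_eq_square)
      moreover have "0 \<le> \<alpha> * (x - l T)" using x c by (simp add: \<alpha>_def l_def)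
      ultimately show ?thesis by simp
    qed
    then have "exp ((- \<alpha>) * x + \<alpha>\<^sup>2 * T + \<alpha> * (l s0 + M' - \<alpha> * s0)) < \<epsilon>"
      using s0(1) by (meson exp_le_cancel_iff order.strict_trans1)
    moreover have "l T = \<eta> T + K + M" by (simp add: l_def)
    ultimately show "v T x \<le> exp (- c * (x - (\<eta> T + K + M))) + e"
      using \<open>0 \<le> D T x\<close> unfolding D_def e1 by (simp add: \<epsilon>_def)
  qed
  show ?thesis
  proof (intro exI[of _ "exp (c * (K + M))"] conjI allI)
    fix t x
    have "v t x \<le> exp (- c * (x - (\<eta> t + K + M)))"
    proof (cases "\<eta> t + K + M \<le> x")
      case False
      then have "0 \<le> - c * (x - (\<eta> t + K + M))" using c by (simp add: mult_le_0_iff)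
      then have "1 \<le> exp (- c * (x - (\<eta> t + K + M)))" by (simp only: one_le_exp_iff)
      then show ?thesis using solution_range[OF v, of t x] by linarith
    qed (rule *)
    also have "\<dots> = exp (c * (K + M)) * exp (- c * (x - \<eta> t))"
      by (simp add: algebra_simps flip: exp_add)
    finally show "v t x \<le> exp (c * (K + M)) * exp (- c * (x - \<eta> t))" .
  qed simp
qed

end

section \<open>Lipschitz bounds and spreading of positivity\<close>

lemma heat_op_exp_time:
  assumes "heat_op u t x r"
  shows "heat_op (\<lambda>t x. exp (- l * (t - s)) * u t x) t x (exp (- l * (t - s)) * (r - l * u t x))"
proof -
  obtain a b d where u: "((\<lambda>s. u s x) has_real_derivative a) (at t)"
    "\<And>y. (u t has_real_derivative b y) (at y)" "(b has_real_derivative d) (at x)" "r = a - d"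
    using assms unfolding heat_op_def by blast
  show ?thesis
    by (rule heat_opI[of _ _ "exp (- l * (t - s)) * (a - l * u t x)" _ "\<lambda>y. exp (- l * (t - s)) * b y"
          "exp (- l * (t - s)) * d"])
      (use u in \<open>auto intro!: derivative_eq_intros simp: right_diff_distrib\<close>)
qed

text \<open>The heat kernel, normalised to have height \<open>1\<close> at time \<open>s\<close>, where its variance is \<open>2 a\<close>.\<close>
lemma heat_op_gaussian:
  assumes "0 < a + t - s"
  shows "heat_op (\<lambda>t x. exp ((ln a - ln (a + t - s)) / 2 - (x - x\<^sub>0)\<^sup>2 / (4 * (a + t - s)))) t x 0"
proof -
  define w where "w = a + t - s"
  define G where "G = (\<lambda>t x. exp ((ln a - ln (a + t - s)) / 2 - (x - x\<^sub>0)\<^sup>2 / (4 * (a + t - s))))"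
  have w: "w > 0" using assms by (simp add: w_def)
  have "heat_op G t x 0"
  proof (rule heat_opI)
    show "((\<lambda>r. G r x) has_real_derivative G t x * ((x - x\<^sub>0)\<^sup>2 / (4 * w\<^sup>2) - 1 / (2 * w))) (at t)"
    proof -
      have "((\<lambda>r. (ln a - ln (a + r - s)) / 2 - (x - x\<^sub>0)\<^sup>2 / (4 * (a + r - s))) has_real_derivative
          (x - x\<^sub>0)\<^sup>2 / (4 * w\<^sup>2) - 1 / (2 * w)) (at t)"
      proof (rule DERIV_chain2[where g = "\<lambda>r. a + r - s" and Db = 1, simplified])
        show "((\<lambda>w. (ln a - ln w) / 2 - (x - x\<^sub>0)\<^sup>2 / (4 * w)) has_real_derivative
          (x - x\<^sub>0)\<^sup>2 / (4 * w\<^sup>2) - 1 / (2 * w)) (at (a + t - s))"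
          unfolding w_def[symmetric] using w
          by (auto intro!: derivative_eq_intros simp: power2_eq_square field_simps)
      qed (auto intro!: derivative_eq_intros)
      then show ?thesis unfolding G_def by (rule DERIV_fun_exp)
    qed
    show "(G t has_real_derivative G t y * (- (y - x\<^sub>0) / (2 * w))) (at y)" for y
      unfolding G_def w_def[symmetric] using w
      by (auto intro!: derivative_eq_intros simp: field_simps)
    have "((\<lambda>y. G t y * (- (y - x\<^sub>0) / (2 * w))) has_real_derivative
       G t x * (- (x - x\<^sub>0) / (2 * w)) * (- (x - x\<^sub>0) / (2 * w)) + G t x * (- 1 / (2 * w))) (at x)"
      unfolding G_def w_def[symmetric] using w
      by (auto intro!: derivative_eq_intros simp: field_simps)
    then show "((\<lambda>y. G t y * (- (y - x\<^sub>0) / (2 * w))) has_real_derivative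
       G t x * ((x - x\<^sub>0)\<^sup>2 / (4 * w\<^sup>2) - 1 / (2 * w))) (at x)"
      by (simp add: field_simps power2_eq_square)
  qed simp
  then show ?thesis by (simp only: G_def)
qed

context ignition
begin

text \<open>For a fixed centre \<open>a\<close>, the odd part \<open>v (a + z) - v (a - z)\<close> vanishes at \<open>z = 0\<close>, is at most \<open>1\<close> at
  \<open>z = 1\<close>, and solves a heat equation with right-hand side bounded by \<open>L\<close>. On the strip
  \<open>0 \<le> z \<le> 1\<close> a concave parabola is a stationary barrier; the added term \<open>2 exp (s - t) cos z\<close> is a heat
  solution that dominates the initial values, and it fades because the solution is ancient.\<close>
lemma symmetric_difference_bound:
  assumes v: "solution v" and z: "0 \<le> z" "z \<le> 1"
  shows "v t (a + z) - v t (a - z) \<le> (1 + L / 2) * z"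
proof (rule field_le_epsilon)
  fix e :: real assume "e > 0"
  obtain s where s: "exp (ln 2 - 1 * (t - s)) < e" "s \<le> t"
    using eventually_happens[OF exp_decay_backwards[OF zero_less_one \<open>e > 0\<close>]]
    by (meson trivial_limit_at_bot_linorder)
  define b where "b = (\<lambda>t z. (1 + L / 2) * z - L / 2 * z\<^sup>2 + 2 * exp (s - t) * cos z)"
  define D where "D = (\<lambda>t z. b t z - (v t (a + 1 * z) - v t (a + (-1) * z)))"
  have b: "heat_op b t z L" for t z
    unfolding b_def
    by (rule heat_opI[of _ _ "- 2 * exp (s - t) * cos z" _
          "\<lambda>z. 1 + L / 2 - L * z - 2 * exp (s - t) * sin z" "- L - 2 * exp (s - t) * cos z"])
      (auto intro!: derivative_eq_intros)
  have cos: "1 / 2 \<le> cos z" if "0 \<le> z" "z \<le> 1" for z :: real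
  proof -
    have "z \<le> pi / 3" "pi / 3 \<le> pi" using that pi_gt3 by auto
    then have "cos (pi / 3) \<le> cos z" using that by (intro cos_monotone_0_pi_le) auto
    then show ?thesis by (simp add: cos_60)
  qed
  have quad: "0 \<le> (1 + L / 2) * z - L / 2 * z\<^sup>2" if "0 \<le> z" "z \<le> 1" for z
  proof -
    have "L / 2 * z \<le> L / 2" using that L_pos by (intro mult_left_le) auto
    then have "0 \<le> z * (1 + L / 2 - L / 2 * z)" using that by (intro mult_nonneg_nonneg) auto
    then show ?thesis by (simp add: algebra_simps power2_eq_square)
  qed
  have expcos: "exp (s - t) \<le> 2 * exp (s - t) * cos z" if "0 \<le> z" "z \<le> 1" for t z
    using mult_left_mono[OF cos[OF that], of "2 * exp (s - t)"] by simp
  have range: "\<bar>v t y - v t y'\<bar> \<le> 1" for t y y'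
    using solution_range[OF v, of t y] solution_range[OF v, of t y'] by linarith
  have "0 \<le> D t z"
  proof (rule parabolic_comparison[where D = D and \<Omega> = "UNIV \<times> {0..1}" and s = s and T = t
        and b = 1 and \<Lambda> = 0 and t = t and x = z])
    show "closed (UNIV \<times> {0..1::real} :: (real \<times> real) set)" by (intro closed_Times) auto
    show "continuous_on (UNIV \<times> {0..1} \<inter> {s..t} \<times> UNIV) (\<lambda>(t, x). D t x)"
      unfolding case_prod_beta D_def b_def by (intro continuous_intros solution_continuous[OF v])
    show "- 1 \<le> D r y" if "(r, y) \<in> UNIV \<times> {0..1}" for r y
    proof -
      have y: "0 \<le> y" "y \<le> 1" using that by auto
      show ?thesis
        using quad[OF y] expcos[OF y, of r] exp_gt_zero[of "s - r"] range[of r "a + 1 * y" "a + (-1) * y"]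
        unfolding D_def b_def by linarith
    qed
    show "0 \<le> D s y" if "(s, y) \<in> UNIV \<times> {0..1}" for y
    proof -
      have y: "0 \<le> y" "y \<le> 1" using that by auto
      show ?thesis
        using quad[OF y] expcos[OF y, of s] range[of s "a + 1 * y" "a + (-1) * y"]
        unfolding D_def b_def by simp
    qed
    fix r y assume ry: "(r, y) \<in> UNIV \<times> {0..1}" and neg: "D r y < 0"
    show "(r, y) \<in> interior (UNIV \<times> {0..1}) \<and> (\<exists>\<rho>. heat_op D r y \<rho> \<and> 0 * D r y \<le> \<rho>)"
    proof
      have "y \<noteq> 0" using neg by (auto simp: D_def b_def)
      moreover have "y \<noteq> 1"
      proof
        assume "y = 1"
        then have "1 + 2 * exp (s - r) * cos 1 - 1 \<le> D r y"
          using range[of r "a + 1" "a - 1"] by (simp add: D_def b_def)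
        then show False using neg expcos[of 1 r] exp_gt_zero[of "s - r"] by linarith
      qed
      ultimately show "(r, y) \<in> interior (UNIV \<times> {0..1})" using ry by (simp add: interior_Times)
      have "heat_op D r y (L - (f r (v r (a + 1 * y)) - f r (v r (a + (-1) * y))))"
        unfolding D_def
        by (intro heat_op_diff b heat_op_affine_space solution_heat_op v) auto
      moreover have "f r (v r (a + 1 * y)) \<le> L" "0 \<le> f r (v r (a + (-1) * y))"
        using solution_range[OF v, THEN less_imp_le] by (auto intro!: f_bounds f_nonneg)
      ultimately show "\<exists>\<rho>. heat_op D r y \<rho> \<and> 0 * D r y \<le> \<rho>" by fastforce
    qed
  qed (use z s in auto)
  moreover have "2 * exp (s - t) * cos z \<le> 2 * exp (s - t)" by simp
  moreover have "exp (ln 2 - 1 * (t - s)) = 2 * exp (s - t)"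
    using exp_add[of "ln 2" "s - t"] by (simp add: algebra_simps)
  moreover have "0 \<le> L / 2 * z\<^sup>2" using L_pos by simp
  ultimately show "v t (a + z) - v t (a - z) \<le> (1 + L / 2) * z + e"
    using s(1) unfolding D_def b_def mult_1 mult_minus1 add_uminus_conv_diff by linarith
qed

text \<open>Reflecting in the midpoint of two points turns the bound on odd parts into a Lipschitz bound.\<close>
lemma solution_lipschitz:
  assumes v: "solution v"
  shows "\<bar>v t x - v t y\<bar> \<le> (1 + L / 2) * \<bar>x - y\<bar>"
proof -
  have *: "v t x - v t y \<le> (1 + L / 2) * \<bar>x - y\<bar>" if v: "solution v" and "y \<le> x" for v x y
  proof (cases "x - y \<le> 2")
    case True
    have mid: "(x + y) / 2 + (x - y) / 2 = x" "(x + y) / 2 - (x - y) / 2 = y" by (simp_all add: field_simps)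
    have "v t ((x + y) / 2 + (x - y) / 2) - v t ((x + y) / 2 - (x - y) / 2) \<le> (1 + L / 2) * ((x - y) / 2)"
      using True that by (intro symmetric_difference_bound) auto
    also have "\<dots> \<le> (1 + L / 2) * \<bar>x - y\<bar>" using that L_pos by (intro mult_left_mono) auto
    finally show ?thesis unfolding mid .
  next
    case False
    have "1 * 1 \<le> (1 + L / 2) * \<bar>x - y\<bar>" using False L_pos by (intro mult_mono) auto
    then show ?thesis using solution_range[OF v, of t x] solution_range[OF v, of t y] by linarith
  qed
  have "\<bar>v t x - v t y\<bar> \<le> (1 + L / 2) * \<bar>x - y\<bar>" if "y \<le> x" for x y
    using *[OF v that] *[OF solution_affine_space[OF v, of "-1" 0], of "- x" "- y"] that
    by (simp add: abs_le_iff)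
  from this[of x y] this[of y x] show ?thesis by (cases "y \<le> x") (auto simp: abs_minus_commute)
qed

text \<open>A quantitative strong maximum principle. If two ordered solutions differ by \<open>\<kappa>\<close> at a point, then by
  the Lipschitz bound they differ by \<open>\<kappa> / 2\<close> on an interval of known radius \<open>\<rho>\<close>. A narrow heat
  kernel minus its value at distance \<open>\<rho>\<close>, damped by \<open>exp (- L t)\<close>, fits below the difference at the
  initial time. One time unit later the kernel has height of order \<open>sqrt a\<close> on \<open>[- M, M]\<close>, which
  beats the subtracted constant \<open>exp (- \<rho>\<^sup>2 / (4 a))\<close> when \<open>a\<close> is small. The bound \<open>\<kappa>'\<close> is independent of
  the solutions, the time and the place.\<close>
lemma positivity_spreads:
  assumes "\<kappa> > 0"
  shows "\<exists>\<kappa>'>0. \<forall>v\<^sub>1 v\<^sub>2 t\<^sub>0 x\<^sub>0. solution v\<^sub>1 \<longrightarrow> solution v\<^sub>2 \<longrightarrow> (\<forall>t x. v\<^sub>2 t x \<le> v\<^sub>1 t x) \<longrightarrow>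
     \<kappa> \<le> v\<^sub>1 t\<^sub>0 x\<^sub>0 - v\<^sub>2 t\<^sub>0 x\<^sub>0 \<longrightarrow> (\<forall>x. \<bar>x - x\<^sub>0\<bar> \<le> M \<longrightarrow> \<kappa>' \<le> v\<^sub>1 (t\<^sub>0 + 1) x - v\<^sub>2 (t\<^sub>0 + 1) x)"
proof -
  define \<rho> where "\<rho> = \<kappa> / (4 * (1 + L / 2))"
  have \<rho>: "\<rho> > 0" "2 * (1 + L / 2) * \<rho> = \<kappa> / 2"
    using assms L_pos by (auto simp: \<rho>_def field_simps)
  have "filterlim (\<lambda>a. (ln a - ln 2) / 2 - M\<^sup>2 / 4 + (\<rho>\<^sup>2 / 4) / a) at_top (at_right 0)"
  proof -
    have "\<rho>\<^sup>2 / 4 > 0" using \<rho> by simp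
    then show ?thesis by real_asymp
  qed
  then have "\<forall>\<^sub>F a in at_right 0. 0 < (ln a - ln 2) / 2 - M\<^sup>2 / 4 + (\<rho>\<^sup>2 / 4) / a"
    by (simp add: filterlim_at_top_dense)
  moreover have "\<forall>\<^sub>F a in at_right 0. a < (1::real)" by (rule order_tendstoD[OF tendsto_ident_at]) simp
  moreover have "\<forall>\<^sub>F a in at_right 0. (0::real) < a" by (rule eventually_at_right_less)
  ultimately have "\<forall>\<^sub>F a in at_right 0. 0 < (ln a - ln 2) / 2 - M\<^sup>2 / 4 + (\<rho>\<^sup>2 / 4) / a \<and> a < 1 \<and> 0 < a"
    by eventually_elim auto
  then obtain a where a: "0 < (ln a - ln 2) / 2 - M\<^sup>2 / 4 + (\<rho>\<^sup>2 / 4) / a" "a < 1" "0 < a"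
    using eventually_happens[of _ "at_right (0::real)"] by auto
  define \<delta> where "\<delta> = exp (- (\<rho>\<^sup>2 / (4 * a)))"
  define \<mu> where "\<mu> = exp ((ln a - ln 2) / 2 - M\<^sup>2 / 4) - \<delta>"
  have "\<delta> < exp ((ln a - ln 2) / 2 - M\<^sup>2 / 4)" using a(1) by (simp add: \<delta>_def)
  then have \<mu>: "\<mu> > 0" by (simp add: \<mu>_def)
  define \<kappa>' where "\<kappa>' = exp (- L) * (\<kappa> / 2 * \<mu>)"
  have "\<kappa>' > 0" using \<mu> assms by (simp add: \<kappa>'_def)
  moreover have "\<kappa>' \<le> v\<^sub>1 (t\<^sub>0 + 1) x - v\<^sub>2 (t\<^sub>0 + 1) x"
    if v: "solution v\<^sub>1" "solution v\<^sub>2" and le: "\<And>t x. v\<^sub>2 t x \<le> v\<^sub>1 t x"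
      and \<kappa>: "\<kappa> \<le> v\<^sub>1 t\<^sub>0 x\<^sub>0 - v\<^sub>2 t\<^sub>0 x\<^sub>0" and x: "\<bar>x - x\<^sub>0\<bar> \<le> M" for v\<^sub>1 v\<^sub>2 t\<^sub>0 x\<^sub>0 x
  proof -
    define G where "G = (\<lambda>t x. exp ((ln a - ln (a + t - t\<^sub>0)) / 2 - (x - x\<^sub>0)\<^sup>2 / (4 * (a + t - t\<^sub>0))))"
    define S where "S = (\<lambda>t x. exp (- L * (t - t\<^sub>0)) * (\<kappa> / 2 * (G t x - \<delta>)))"
    define D where "D = (\<lambda>t x. v\<^sub>1 t x - v\<^sub>2 t x - S t x)"
    have G: "0 < G t x" "t\<^sub>0 \<le> t \<Longrightarrow> G t x \<le> 1" for t x
    proof -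
      show "0 < G t x" by (simp add: G_def)
      assume "t\<^sub>0 \<le> t"
      then have "ln a \<le> ln (a + t - t\<^sub>0)" "0 \<le> (x - x\<^sub>0)\<^sup>2 / (4 * (a + t - t\<^sub>0))" using a by auto
      then show "G t x \<le> 1" unfolding G_def exp_le_one_iff by argo
    qed
    have S: "S t x \<le> \<kappa> / 2" if "t\<^sub>0 \<le> t" for t x
    proof -
      have "\<kappa> / 2 * (G t x - \<delta>) \<le> \<kappa> / 2"
        using G(2)[OF that, of x] exp_gt_zero[of "- (\<rho>\<^sup>2 / (4 * a))"] assms
        by (intro mult_left_le) (auto simp only: \<delta>_def)
      moreover have "exp (- L * (t - t\<^sub>0)) \<le> 1" using that L_pos by simp
      ultimately have "S t x \<le> 1 * (\<kappa> / 2)"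
        unfolding S_def using assms
        by (intro order_trans[OF mult_left_mono mult_right_mono]) auto
      then show ?thesis by simp
    qed
    have "0 \<le> D (t\<^sub>0 + 1) x"
    proof (rule parabolic_comparison[where D = D and \<Omega> = UNIV and s = t\<^sub>0 and T = "t\<^sub>0 + 1"
        and b = "\<kappa> / 2" and \<Lambda> = "- L" and t = "t\<^sub>0 + 1" and x = x])
      show "continuous_on (UNIV \<inter> {t\<^sub>0..t\<^sub>0 + 1} \<times> UNIV) (\<lambda>(t, x). D t x)"
        unfolding case_prod_beta D_def S_def G_def
        using a(3) by (intro continuous_intros solution_continuous[OF v(1)] solution_continuous[OF v(2)]) auto
      show "- (\<kappa> / 2) \<le> D t x" if "t\<^sub>0 \<le> t" for t x
        using S[OF that, of x] le[of t x] unfolding D_def by linarith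
      show "0 \<le> D t\<^sub>0 x" for x
      proof (cases "\<bar>x - x\<^sub>0\<bar> \<le> \<rho>")
        case True
        have "2 * (1 + L / 2) * \<bar>x - x\<^sub>0\<bar> \<le> \<kappa> / 2"
          unfolding \<rho>(2)[symmetric] using True L_pos by (intro mult_left_mono) auto
        then have "\<kappa> / 2 \<le> v\<^sub>1 t\<^sub>0 x - v\<^sub>2 t\<^sub>0 x"
          using solution_lipschitz[OF v(1), of t\<^sub>0 x x\<^sub>0] solution_lipschitz[OF v(2), of t\<^sub>0 x x\<^sub>0] \<kappa> by linarith
        then show ?thesis using S[of t\<^sub>0 x] by (simp add: D_def)
      next
        case False
        then have "\<rho>\<^sup>2 \<le> (x - x\<^sub>0)\<^sup>2" using \<rho>(1) by (simp add: abs_le_square_iff[symmetric])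
        then have "G t\<^sub>0 x \<le> \<delta>" using a by (simp add: G_def \<delta>_def divide_right_mono)
        then have "S t\<^sub>0 x \<le> 0" using assms by (simp add: S_def mult_le_0_iff)
        then show ?thesis using le[of t\<^sub>0 x] by (simp add: D_def)
      qed
      fix t x assume t: "t\<^sub>0 < t"
      have "heat_op D t x (f t (v\<^sub>1 t x) - f t (v\<^sub>2 t x) -
          exp (- L * (t - t\<^sub>0)) * (\<kappa> / 2 * (0 - 0) - L * (\<kappa> / 2 * (G t x - \<delta>))))"
        unfolding D_def S_def G_def using t a(3)
        by (intro heat_op_diff heat_op_exp_time heat_op_cmult heat_op_gaussian heat_op_const
            solution_heat_op v) auto
      moreover have "\<bar>f t (v\<^sub>1 t x) - f t (v\<^sub>2 t x)\<bar> \<le> L * \<bar>v\<^sub>1 t x - v\<^sub>2 t x\<bar>"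
        using solution_range[OF v(1), of t x] solution_range[OF v(2), of t x] by (intro f_lipschitz) auto
      then have *: "- (L * (v\<^sub>1 t x - v\<^sub>2 t x)) \<le> f t (v\<^sub>1 t x) - f t (v\<^sub>2 t x)"
        using le[of t x] by (auto simp only: abs_le_iff abs_of_nonneg diff_ge_0_iff_ge)
      have "- L * D t x \<le> f t (v\<^sub>1 t x) - f t (v\<^sub>2 t x) -
          exp (- L * (t - t\<^sub>0)) * (\<kappa> / 2 * (0 - 0) - L * (\<kappa> / 2 * (G t x - \<delta>)))"
      proof -
        have "exp (- L * (t - t\<^sub>0)) * (\<kappa> / 2 * (0 - 0) - L * (\<kappa> / 2 * (G t x - \<delta>))) = - (L * S t x)"
          by (simp add: S_def)
        moreover have "- L * D t x = - (L * (v\<^sub>1 t x - v\<^sub>2 t x)) + L * S t x"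
          by (simp add: D_def algebra_simps)
        ultimately show ?thesis using * by linarith
      qed
      ultimately show "(t, x) \<in> interior UNIV \<and> (\<exists>r. heat_op D t x r \<and> - L * D t x \<le> r)" by auto
    qed auto
    moreover have "\<kappa>' \<le> S (t\<^sub>0 + 1) x"
    proof -
      have "(x - x\<^sub>0)\<^sup>2 \<le> M\<^sup>2" using x by (simp add: abs_le_square_iff[symmetric])
      then have "(x - x\<^sub>0)\<^sup>2 / (4 * (a + 1)) \<le> M\<^sup>2 / 4"
        using a by (intro frac_le) auto
      moreover have "ln (a + 1) \<le> ln 2" using a by simp
      ultimately have "(ln a - ln 2) / 2 - M\<^sup>2 / 4 \<le> (ln a - ln (a + 1)) / 2 - (x - x\<^sub>0)\<^sup>2 / (4 * (a + 1))"
        by argo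
      moreover have "G (t\<^sub>0 + 1) x = exp ((ln a - ln (a + 1)) / 2 - (x - x\<^sub>0)\<^sup>2 / (4 * (a + 1)))"
        by (simp add: G_def add_diff_eq)
      ultimately have "\<mu> \<le> G (t\<^sub>0 + 1) x - \<delta>" by (simp add: \<mu>_def)
      then show ?thesis unfolding \<kappa>'_def S_def using assms by (auto intro!: mult_left_mono)
    qed
    ultimately show ?thesis by (simp add: D_def)
  qed
  ultimately show ?thesis by blast
qed

end

section \<open>The reference front and its increments\<close>

lemma heat_op_exp_moving:
  assumes "(\<xi> has_real_derivative d) (at t)"
  shows "heat_op (\<lambda>t x. exp (k * (x - \<xi> t) + q)) t x ((- k * d - k\<^sup>2) * exp (k * (x - \<xi> t) + q))"
proof (rule heat_opI)
  show "((\<lambda>s. exp (k * (x - \<xi> s) + q)) has_real_derivative - k * d * exp (k * (x - \<xi> t) + q)) (at t)"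
    using assms by (auto intro!: derivative_eq_intros)
  show "((\<lambda>x. exp (k * (x - \<xi> t) + q)) has_real_derivative k * exp (k * (y - \<xi> t) + q)) (at y)" for y
    by (auto intro!: derivative_eq_intros)
  show "((\<lambda>x. k * exp (k * (x - \<xi> t) + q)) has_real_derivative k * (k * exp (k * (x - \<xi> t) + q))) (at x)"
    by (auto intro!: derivative_eq_intros)
qed (simp add: algebra_simps power2_eq_square)

text \<open>A bounded concave increasing function. Composing a heat solution with a concave function yields a
  supersolution of the heat equation, so \<open>cap\<close> truncates travelling exponentials smoothly.\<close>
definition cap :: "real \<Rightarrow> real" where
  "cap z = z / (1 + z)"

lemma cap_bounds:
  assumes "0 \<le> z"
  shows "0 \<le> cap z" "cap z \<le> 1" "cap z \<le> z"
  using assms by (auto simp: cap_def field_simps)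

lemma cap_lower: "0 \<le> z \<Longrightarrow> min 1 z / 2 \<le> cap z"
  by (auto simp: cap_def min_def field_simps intro: mult_left_le)

lemma heat_op_cap_exp:
  "\<exists>r\<ge>0. heat_op (\<lambda>t x. cap (exp (k * x + k\<^sup>2 * t + q))) t x r"
proof -
  define Z where "Z = (\<lambda>t x. exp (k * x + k\<^sup>2 * t + q))"
  have Z: "Z t x > 0" "1 + Z t x > 0" "1 + Z t x \<noteq> 0" for t x
  proof -
    show "Z t x > 0" by (simp add: Z_def)
    then show "1 + Z t x > 0" by simp
    then show "1 + Z t x \<noteq> 0" by simp
  qed
  have Zt: "((\<lambda>s. Z s x) has_real_derivative k\<^sup>2 * Z t x) (at t)" for t x
    unfolding Z_def by (auto intro!: derivative_eq_intros)
  have Zx: "(Z t has_real_derivative k * Z t x) (at x)" for t x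
    unfolding Z_def by (auto intro!: derivative_eq_intros)
  have "heat_op (\<lambda>t x. cap (Z t x)) t x
      (k\<^sup>2 * Z t x / (1 + Z t x)\<^sup>2 - k\<^sup>2 * Z t x * (1 - Z t x) / (1 + Z t x) ^ 3)"
  proof (rule heat_opI)
    show "((\<lambda>s. cap (Z s x)) has_real_derivative k\<^sup>2 * Z t x / (1 + Z t x)\<^sup>2) (at t)"
      unfolding cap_def by (rule derivative_eq_intros Zt Z(3) refl)+
        (simp add: field_simps power2_eq_square)
    show "((\<lambda>x. cap (Z t x)) has_real_derivative k * Z t y / (1 + Z t y)\<^sup>2) (at y)" for y
      unfolding cap_def by (rule derivative_eq_intros Zx Z(3) refl)+
        (simp add: field_simps power2_eq_square)
    have "((\<lambda>x. k * Z t x / (1 + Z t x)\<^sup>2) has_real_derivative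
       (k * (k * Z t x) * (1 + Z t x)\<^sup>2 - k * Z t x * (2 * (1 + Z t x) * (k * Z t x))) / ((1 + Z t x)\<^sup>2)\<^sup>2) (at x)"
      using Z(3) by (auto intro!: derivative_eq_intros Zx simp: power2_eq_square)
    moreover have "(k * (k * z) * (1 + z)\<^sup>2 - k * z * (2 * (1 + z) * (k * z))) / ((1 + z)\<^sup>2)\<^sup>2
      = k\<^sup>2 * z * (1 - z) / (1 + z) ^ 3" if "1 + z \<noteq> 0" for z
    proof -
      have "(k * (k * z) * (1 + z)\<^sup>2 - k * z * (2 * (1 + z) * (k * z))) = (k\<^sup>2 * z * (1 - z)) * (1 + z)"
        by (simp add: algebra_simps power2_eq_square)
      moreover have "((1 + z)\<^sup>2)\<^sup>2 = (1 + z) ^ 3 * (1 + z)" by (simp add: power_numeral_reduce)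
      ultimately show ?thesis using that by simp
    qed
    ultimately show "((\<lambda>x. k * Z t x / (1 + Z t x)\<^sup>2) has_real_derivative
       k\<^sup>2 * Z t x * (1 - Z t x) / (1 + Z t x) ^ 3) (at x)" using Z(3) by simp
  qed simp
  moreover have "0 \<le> k\<^sup>2 * Z t x / (1 + Z t x)\<^sup>2 - k\<^sup>2 * Z t x * (1 - Z t x) / (1 + Z t x) ^ 3"
  proof -
    have "k\<^sup>2 * Z t x * (1 - Z t x) \<le> k\<^sup>2 * Z t x * (1 + Z t x)"
      using Z(1)[of t x] by (intro mult_left_mono) auto
    then have "k\<^sup>2 * Z t x * (1 - Z t x) / (1 + Z t x) ^ 3 \<le> k\<^sup>2 * Z t x * (1 + Z t x) / (1 + Z t x) ^ 3"
      using Z(2)[of t x] by (intro divide_right_mono) auto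
    also have "\<dots> = k\<^sup>2 * Z t x / (1 + Z t x)\<^sup>2"
      using Z(3)[of t x] by (simp add: power3_eq_cube power2_eq_square)
    finally show ?thesis by simp
  qed
  ultimately show ?thesis unfolding Z_def by blast
qed

text \<open>A wave \<open>U\<close> with the features of the reference wave: steep near its interface \<open>\<xi>\<close>, with exponentially
  decaying values and slopes ahead of it. \<open>U_moving\<close> is the chain rule for a frame moving
  with velocity \<open>h'\<close>.\<close>
locale ignition_front = ignition +
  fixes U Ux :: "real \<Rightarrow> real \<Rightarrow> real" and \<xi> \<xi>' :: "real \<Rightarrow> real" and c\<^sub>0 C\<^sub>0 X :: real
  assumes U: "solution U"
    and U_interface: "interface_location U \<xi>"
    and U_moving: "(h has_real_derivative h') (at t) \<Longrightarrow>
      heat_op (\<lambda>t x. U t (x - h t)) t x (f t (U t (x - h t)) - h' * Ux t (x - h t))"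
    and U_deriv: "(U t has_real_derivative Ux t x) (at x)"
    and Ux_neg: "Ux t x < 0"
    and U_steep: "M > 0 \<Longrightarrow> \<exists>C>0. \<forall>t. \<forall>y\<in>{-M..M}. Ux t (y + \<xi> t) < - C"
    and c0_pos: "0 < c\<^sub>0" and C0_pos: "0 < C\<^sub>0"
    and U_tail: "0 \<le> y \<Longrightarrow> U t (y + \<xi> t) \<le> \<theta> * exp (- c\<^sub>0 * y)"
    and Ux_tail: "0 \<le> y \<Longrightarrow> - (C\<^sub>0 * exp (- c\<^sub>0 * y)) \<le> Ux t (y + \<xi> t)"
    and \<xi>_deriv: "(\<xi> has_real_derivative \<xi>' t) (at t)"
    and \<xi>'_bound: "\<bar>\<xi>' t\<bar> \<le> X"
    and U_\<xi>: "U t (\<xi> t) = \<theta>"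
begin

lemma U_strict_antimono: "x < y \<Longrightarrow> U t y < U t x"
  using U_deriv Ux_neg by (meson DERIV_neg_imp_decreasing)

lemma U_antimono: "x \<le> y \<Longrightarrow> U t y \<le> U t x"
  using U_strict_antimono[of x y t] by (cases "x = y") auto

text \<open>Increments of the front also decay exponentially behind the interface. There both values exceed \<open>\<theta>'\<close>, so the
  increment satisfies a heat equation with absorption \<open>\<beta>\<close>. For \<open>\<nu>\<close> small compared with \<open>\<beta>\<close> and the
  maximal speed \<open>X\<close>, the exponential \<open>exp (\<nu> (x - \<xi> t))\<close> in the frame of the interface is a
  supersolution, and \<open>exp (- \<beta> (t - s))\<close> takes care of the initial values.\<close>
lemma U_increment_left:
  "\<exists>A>0. \<exists>\<nu>>0. \<forall>e t x. 0 \<le> e \<longrightarrow> U t (x - e) - U t x \<le> A * e * exp (\<nu> * (x - \<xi> t))"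
proof -
  define A\<^sub>0 where "A\<^sub>0 = 1 + L / 2"
  have "A\<^sub>0 > 0" using L_pos by (simp add: A\<^sub>0_def)
  obtain M where M: "M > 0" "\<And>t y. y \<le> - M \<Longrightarrow> \<theta>' < U t (y + \<xi> t)"
    using interface_bounds[OF U_interface, of "1 - \<theta>'"] theta by auto
  have "X \<ge> 0" using \<xi>'_bound[of 0] by linarith
  define \<nu> where "\<nu> = min 1 (\<beta> / (X + 1))"
  have \<nu>: "0 < \<nu>" "\<nu> \<le> 1" using beta_pos \<open>X \<ge> 0\<close> by (auto simp: \<nu>_def)
  have "\<nu> * (X + 1) \<le> \<beta> / (X + 1) * (X + 1)"
    using \<open>X \<ge> 0\<close> by (intro mult_right_mono) (auto simp: \<nu>_def)
  then have \<nu>\<beta>: "\<nu> * (X + 1) \<le> \<beta>" using \<open>X \<ge> 0\<close> by simp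
  have \<xi>_cont: "continuous_on S \<xi>" for S
    using \<xi>_deriv by (intro DERIV_continuous_on) (auto intro: has_field_derivative_at_within)
  have *: "U t (x - e) - U t x \<le> A\<^sub>0 * e * exp (\<nu> * (x - \<xi> t) + \<nu> * M)" if e: "0 \<le> e" for e t x
  proof (cases "x \<le> \<xi> t - M")
    case False
    have "0 \<le> \<nu> * (x - \<xi> t + M)" using False \<nu>(1) by simp
    then have "1 \<le> exp (\<nu> * (x - \<xi> t) + \<nu> * M)" by (simp add: algebra_simps)
    then have "A\<^sub>0 * e * 1 \<le> A\<^sub>0 * e * exp (\<nu> * (x - \<xi> t) + \<nu> * M)"
      using e \<open>A\<^sub>0 > 0\<close> by (intro mult_left_mono) auto
    moreover have "U t (x - e) - U t x \<le> A\<^sub>0 * e"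
      using solution_lipschitz[OF U, of t "x - e" x] e by (simp add: A\<^sub>0_def)
    ultimately show ?thesis by simp
  next
    case True
    show ?thesis
    proof (rule field_le_epsilon)
      fix \<epsilon> :: real assume "\<epsilon> > 0"
      define \<epsilon>' where "\<epsilon>' = \<epsilon> / (A\<^sub>0 * e + 1)"
      have pos: "A\<^sub>0 * e + 1 > 0" using \<open>A\<^sub>0 > 0\<close> e by (intro add_nonneg_pos mult_nonneg_nonneg) auto
      then have \<epsilon>': "\<epsilon>' > 0" "A\<^sub>0 * e * \<epsilon>' \<le> \<epsilon>"
        using \<open>\<epsilon> > 0\<close> by (auto simp: \<epsilon>'_def field_simps)
      obtain s where s: "exp (0 - \<beta> * (t - s)) < \<epsilon>'" "s \<le> t"
        using eventually_happens[OF exp_decay_backwards[OF beta_pos \<epsilon>'(1)]]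
        by (meson trivial_limit_at_bot_linorder)
      define E\<^sub>1 where "E\<^sub>1 = (\<lambda>t x. exp (\<nu> * (x - \<xi> t) + \<nu> * M))"
      define E\<^sub>2 where "E\<^sub>2 = (\<lambda>t x. exp (0 * x + (- \<beta>) * t + \<beta> * s))"
      define D where "D = (\<lambda>t x. A\<^sub>0 * e * (E\<^sub>1 t x + E\<^sub>2 t x) - (U t (x + - e) - U t (x + 0)))"
      have E: "0 < E\<^sub>1 t x" "0 < E\<^sub>2 t x" for t x by (simp_all add: E\<^sub>1_def E\<^sub>2_def)
      have dU: "U t (x + - e) - U t (x + 0) \<le> A\<^sub>0 * e" for t x
        using solution_lipschitz[OF U, of t "x + - e" "x + 0"] e by (simp add: A\<^sub>0_def)
      have AE: "0 \<le> A\<^sub>0 * e * (E\<^sub>1 t x + E\<^sub>2 t x)" for t x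
        using E[of t x] e \<open>A\<^sub>0 > 0\<close> by (intro mult_nonneg_nonneg add_nonneg_nonneg) auto
      have AE1: "0 \<le> D t x" if "1 \<le> E\<^sub>1 t x \<or> 1 \<le> E\<^sub>2 t x" for t x
      proof -
        have "A\<^sub>0 * e * 1 \<le> A\<^sub>0 * e * (E\<^sub>1 t x + E\<^sub>2 t x)"
          using that E[of t x] e \<open>A\<^sub>0 > 0\<close> by (intro mult_left_mono) auto
        with dU[of t x] show ?thesis by (simp add: D_def)
      qed
      have "0 \<le> D t x"
      proof (rule parabolic_comparison[where D = D and \<Omega> = "{p. snd p \<le> \<xi> (fst p) - M}" and s = s
            and T = t and b = 1 and \<Lambda> = "- \<beta>" and t = t and x = x])
        show "closed {p. snd p \<le> \<xi> (fst p) - M}"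
          by (intro closed_Collect_le continuous_intros continuous_on_compose2[OF \<xi>_cont]) auto
        show "continuous_on ({p. snd p \<le> \<xi> (fst p) - M} \<inter> {s..t} \<times> UNIV) (\<lambda>(t, x). D t x)"
          unfolding case_prod_beta D_def E\<^sub>1_def E\<^sub>2_def
          by (intro continuous_intros solution_continuous[OF U] continuous_on_compose2[OF \<xi>_cont[of UNIV]]) auto
        show "- 1 \<le> D r y" for r y
          using AE[of r y] solution_range[OF U, of r "y + - e"] solution_range[OF U, of r "y + 0"]
          unfolding D_def by linarith
        show "0 \<le> D s y" for y by (rule AE1) (simp add: E\<^sub>2_def)
        fix r y assume ry: "(r, y) \<in> {p. snd p \<le> \<xi> (fst p) - M}" and neg: "D r y < 0"
        show "(r, y) \<in> interior {p. snd p \<le> \<xi> (fst p) - M} \<and> (\<exists>\<rho>. heat_op D r y \<rho> \<and> - \<beta> * D r y \<le> \<rho>)"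
        proof
          have "y \<noteq> \<xi> r - M"
          proof
            assume "y = \<xi> r - M"
            then have "E\<^sub>1 r y = exp 0" by (simp add: E\<^sub>1_def)
            then show False using AE1[of r y] neg by simp
          qed
          then have "(r, y) \<in> {p. snd p < \<xi> (fst p) - M}" using ry by simp
          moreover have "{p. snd p < \<xi> (fst p) - M} \<subseteq> interior {p. snd p \<le> \<xi> (fst p) - M}"
            by (intro interior_maximal open_Collect_less continuous_intros
                continuous_on_compose2[OF \<xi>_cont[of UNIV]]) auto
          ultimately show "(r, y) \<in> interior {p. snd p \<le> \<xi> (fst p) - M}" by blast
          have h: "heat_op D r y (A\<^sub>0 * e * ((- \<nu> * \<xi>' r - \<nu>\<^sup>2) * E\<^sub>1 r y + (- \<beta> - 0\<^sup>2) * E\<^sub>2 r y)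
              - (f r (U r (y + - e)) - f r (U r (y + 0))))"
            unfolding D_def E\<^sub>1_def E\<^sub>2_def
            by (intro heat_op_diff heat_op_cmult heat_op_add heat_op_exp heat_op_exp_moving \<xi>_deriv
                solution_heat_op[OF solution_translate[OF U]])
          have "\<theta>' \<le> U r (y + 0)" using M(2)[of "y - \<xi> r" r] ry by simp
          then have 1: "\<beta> * (U r (y + - e) - U r (y + 0)) \<le> f r (U r (y + 0)) - f r (U r (y + - e))"
            using f_stable[of "U r (y + 0)" "U r (y + - e)" r] U_antimono[of "y + - e" "y + 0" r] e by simp
          have "- \<nu> * \<xi>' r - \<nu>\<^sup>2 \<ge> - \<beta>"
          proof -
            have "\<nu> * \<xi>' r \<le> \<nu> * X" using \<xi>'_bound[of r] \<nu>(1) by (intro mult_left_mono) auto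
            moreover have "\<nu>\<^sup>2 \<le> \<nu>" using \<nu> by (simp add: power2_eq_square mult_left_le)
            ultimately show ?thesis using \<nu>\<beta> by (simp add: algebra_simps)
          qed
          then have "(- \<beta>) * E\<^sub>1 r y \<le> (- \<nu> * \<xi>' r - \<nu>\<^sup>2) * E\<^sub>1 r y"
            using E[of r y] by (intro mult_right_mono) auto
          then have "A\<^sub>0 * e * ((- \<beta>) * (E\<^sub>1 r y + E\<^sub>2 r y)) \<le>
              A\<^sub>0 * e * ((- \<nu> * \<xi>' r - \<nu>\<^sup>2) * E\<^sub>1 r y + (- \<beta> - 0\<^sup>2) * E\<^sub>2 r y)"
            using e \<open>A\<^sub>0 > 0\<close> by (intro mult_left_mono) (auto simp: algebra_simps)
          moreover have "- \<beta> * D r y = A\<^sub>0 * e * ((- \<beta>) * (E\<^sub>1 r y + E\<^sub>2 r y)) + \<beta> * (U r (y + - e) - U r (y + 0))"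
            by (simp add: D_def algebra_simps)
          ultimately have "- \<beta> * D r y \<le> A\<^sub>0 * e * ((- \<nu> * \<xi>' r - \<nu>\<^sup>2) * E\<^sub>1 r y + (- \<beta> - 0\<^sup>2) * E\<^sub>2 r y)
              - (f r (U r (y + - e)) - f r (U r (y + 0)))"
            using 1 by linarith
          with h show "\<exists>\<rho>. heat_op D r y \<rho> \<and> - \<beta> * D r y \<le> \<rho>" by blast
        qed
      qed (use True s(2) in auto)
      moreover have "E\<^sub>2 t x \<le> \<epsilon>'" using s(1) by (simp add: E\<^sub>2_def algebra_simps)
      then have "A\<^sub>0 * e * E\<^sub>2 t x \<le> \<epsilon>"
        using e \<open>A\<^sub>0 > 0\<close> by (intro order_trans[OF mult_left_mono \<epsilon>'(2)]) auto
      ultimately show "U t (x - e) - U t x \<le> A\<^sub>0 * e * exp (\<nu> * (x - \<xi> t) + \<nu> * M) + \<epsilon>"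
        by (simp add: D_def E\<^sub>1_def distrib_left)
    qed
  qed
  have "U t (x - e) - U t x \<le> A\<^sub>0 * exp (\<nu> * M) * e * exp (\<nu> * (x - \<xi> t))" if "0 \<le> e" for e t x
    using *[OF that, of t x] by (simp only: exp_add mult_ac)
  moreover have "A\<^sub>0 * exp (\<nu> * M) > 0" using \<open>A\<^sub>0 > 0\<close> by simp
  ultimately show ?thesis using \<nu>(1) by blast
qed

lemma U_increment_right:
  assumes "0 \<le> e" and "\<xi> t \<le> x - e"
  shows "U t (x - e) - U t x \<le> e * (C\<^sub>0 * exp (- c\<^sub>0 * (x - e - \<xi> t)))"
proof (cases "e = 0")
  case False
  then have "x - e < x" using assms by simp
  then obtain z where z: "x - e < z" "z < x" "U t x - U t (x - e) = (x - (x - e)) * Ux t z"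
    using MVT2[of "x - e" x "U t" "Ux t"] U_deriv by blast
  have "- (C\<^sub>0 * exp (- c\<^sub>0 * (z - \<xi> t))) \<le> Ux t (z - \<xi> t + \<xi> t)"
    using z assms by (intro Ux_tail) auto
  moreover have "C\<^sub>0 * exp (- c\<^sub>0 * (z - \<xi> t)) \<le> C\<^sub>0 * exp (- c\<^sub>0 * (x - e - \<xi> t))"
    using z c0_pos C0_pos by (intro mult_left_mono) auto
  ultimately have "- Ux t z \<le> C\<^sub>0 * exp (- c\<^sub>0 * (x - e - \<xi> t))" by simp
  then have "e * (- Ux t z) \<le> e * (C\<^sub>0 * exp (- c\<^sub>0 * (x - e - \<xi> t)))"
    using assms by (intro mult_left_mono) auto
  then show ?thesis using z(3) by simp
qed simp

end

section \<open>Comparison with moving translates of the front\<close>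

text \<open>The decay exponent \<open>\<alpha>\<close> lies below the average speed \<open>c\<close> of the front, so that the heat solution
  \<open>exp (- \<alpha> (x - \<alpha> t))\<close> falls behind it, and below the decay exponent \<open>c\<^sub>0\<close> of the front, so that
  this heat solution dominates the tail of the front.\<close>
locale ignition_front_speed = ignition_front +
  fixes c K \<alpha> :: real
  assumes speed: "s \<le> t \<Longrightarrow> \<xi> s + c * (t - s) - K \<le> \<xi> t"
    and \<alpha>: "0 < \<alpha>" "\<alpha> < c" "\<alpha> < c\<^sub>0"
begin

text \<open>The error that is allowed at time \<open>t\<^sub>0\<close>: of order one behind the interface and of size
  \<open>exp (- \<alpha> y)\<close> at distance \<open>y\<close> ahead of it. It travels at speed \<open>\<alpha> < c\<close>, so near the interface it decays
  exponentially in time.\<close>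
definition perturbation :: "real \<Rightarrow> real \<Rightarrow> real \<Rightarrow> real" where
  "perturbation t\<^sub>0 t x = cap (exp (- \<alpha> * (x - \<xi> t\<^sub>0 - \<alpha> * (t - t\<^sub>0))))"

lemma perturbation_bounds: "0 \<le> perturbation t\<^sub>0 t x" "perturbation t\<^sub>0 t x \<le> 1"
  unfolding perturbation_def by (auto intro!: cap_bounds)

lemma perturbation_decay:
  assumes "t\<^sub>0 \<le> t"
  shows "perturbation t\<^sub>0 t x \<le> exp (- \<alpha> * (x - \<xi> t) + \<alpha> * K - \<alpha> * (c - \<alpha>) * (t - t\<^sub>0))"
proof -
  have "perturbation t\<^sub>0 t x \<le> exp (- \<alpha> * (x - \<xi> t\<^sub>0 - \<alpha> * (t - t\<^sub>0)))"
    unfolding perturbation_def by (intro cap_bounds) simp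
  also have "\<dots> \<le> exp (- \<alpha> * (x - \<xi> t) + \<alpha> * K - \<alpha> * (c - \<alpha>) * (t - t\<^sub>0))"
  proof -
    have "\<alpha> * (\<xi> t\<^sub>0 + c * (t - t\<^sub>0) - K) \<le> \<alpha> * \<xi> t"
      using speed[OF assms] \<alpha> by (intro mult_left_mono) auto
    then show ?thesis by (simp add: algebra_simps)
  qed
  finally show ?thesis .
qed

lemma perturbation_continuous: "continuous_on S (\<lambda>p. perturbation t\<^sub>0 (fst p) (snd p))"
proof -
  have "1 + exp r \<noteq> 0" for r :: real using exp_gt_zero[of r] by linarith
  then show ?thesis unfolding perturbation_def cap_def by (intro continuous_intros) auto
qed

lemma perturbation_heat_op: "\<exists>r\<ge>0. heat_op (perturbation t\<^sub>0) t x r"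
proof -
  have "- \<alpha> * (x - \<xi> t\<^sub>0 - \<alpha> * (t - t\<^sub>0)) = (- \<alpha>) * x + (- \<alpha>)\<^sup>2 * t + \<alpha> * (\<xi> t\<^sub>0 - \<alpha> * t\<^sub>0)" for t x
    by (simp add: algebra_simps power2_eq_square)
  then have "perturbation t\<^sub>0 = (\<lambda>t x. cap (exp ((- \<alpha>) * x + (- \<alpha>)\<^sup>2 * t + \<alpha> * (\<xi> t\<^sub>0 - \<alpha> * t\<^sub>0))))"
    by (simp only: perturbation_def fun_eq_iff) simp
  then show ?thesis by (simp only: heat_op_cap_exp)
qed

text \<open>A perturbation of size \<open>q\<close> costs a shift of size \<open>q B\<close>, for all later times. The sign \<open>\<sigma>\<close> treats upper
  and lower bounds together: \<open>\<sigma> = 1\<close> bounds \<open>v\<close> from above, \<open>\<sigma> = -1\<close> from below. The comparison function is the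
  front in the frame shifted by \<open>\<sigma> h t\<close>, plus \<open>\<sigma>\<close> times the perturbation. Behind the
  interface the reaction decreases in \<open>u\<close>, ahead of it there is no reaction, and
  in both regions the perturbation is a supersolution. In a window of radius \<open>M\<close> around the interface the
  reaction may gain \<open>L q exp (- \<omega> (t - t\<^sub>0))\<close> up to a factor; there the front is steeper than \<open>C\<close>, and the shift
  moves fast enough to compensate. Its velocity decays like the perturbation, so the total shift is
  finite and proportional to \<open>q\<close>.\<close>
lemma shifted_comparison:
  "\<exists>q\<^sub>0>0. \<exists>B>0. \<forall>q \<sigma> v t\<^sub>0 t x. 0 < q \<longrightarrow> q \<le> q\<^sub>0 \<longrightarrow> \<sigma> = 1 \<or> \<sigma> = -1 \<longrightarrow> solution v \<longrightarrow>
     (\<forall>x. \<sigma> * v t\<^sub>0 x \<le> \<sigma> * U t\<^sub>0 x + q * perturbation t\<^sub>0 t\<^sub>0 x) \<longrightarrow> t\<^sub>0 \<le> t \<longrightarrow>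
     \<sigma> * v t x \<le> \<sigma> * U t (x - \<sigma> * (q * B)) + q * perturbation t\<^sub>0 t x"
proof -
  define \<delta> where "\<delta> = min (\<theta> / 2) ((1 - \<theta>') / 2)"
  have \<delta>: "\<delta> > 0" "\<delta> \<le> \<theta> / 2" "\<delta> \<le> (1 - \<theta>') / 2" using theta unfolding \<delta>_def by (simp_all only: min.cobounded1 min.cobounded2) simp
  obtain M where M: "M > 0" "\<And>t y. y \<le> - M \<Longrightarrow> 1 - \<delta> < U t (y + \<xi> t)"
    "\<And>t y. M \<le> y \<Longrightarrow> U t (y + \<xi> t) < \<delta>"
    using interface_bounds[OF U_interface \<delta>(1)] by metis
  obtain C where C: "C > 0" "\<And>t y. - M \<le> y \<Longrightarrow> y \<le> M \<Longrightarrow> Ux t (y + \<xi> t) < - C"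
    using U_steep[OF M(1)] by (metis atLeastAtMost_iff)
  define \<omega> where "\<omega> = \<alpha> * (c - \<alpha>)"
  have \<omega>: "\<omega> > 0" using \<alpha> by (simp add: \<omega>_def)
  \<comment> \<open>the summand \<open>1\<close> bounds the shift \<open>q B\<close>, which displaces the window\<close>
  define B where "B = L * exp (\<alpha> * (K + M + 1)) / (\<omega> * C)"
  have B: "B > 0" "B * \<omega> * C = L * exp (\<alpha> * (K + M + 1))"
    using L_pos \<omega> C(1) by (auto simp: B_def)
  define q\<^sub>0 where "q\<^sub>0 = min \<delta> (1 / B)"
  have q0: "q\<^sub>0 > 0" "q\<^sub>0 \<le> \<delta>" "q\<^sub>0 * B \<le> 1"
    using \<delta> B by (auto simp: q\<^sub>0_def min_def field_simps)
  have "\<sigma> * v t x \<le> \<sigma> * U t (x - \<sigma> * (q * B)) + q * perturbation t\<^sub>0 t x"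
    if q: "0 < q" "q \<le> q\<^sub>0" and \<sigma>: "\<sigma> = 1 \<or> \<sigma> = -1" and v: "solution v"
      and init: "\<And>x. \<sigma> * v t\<^sub>0 x \<le> \<sigma> * U t\<^sub>0 x + q * perturbation t\<^sub>0 t\<^sub>0 x"
      and t: "t\<^sub>0 \<le> t" for q \<sigma> v t\<^sub>0 t x
  proof -
    have "q * B \<le> q\<^sub>0 * B" using q(2) B(1) by (intro mult_right_mono) auto
    then have qB: "0 < q * B" "q * B \<le> 1" using q(1) B(1) q0(3) by (simp, linarith)
    define h where "h = (\<lambda>t. q * B * (1 - exp (- \<omega> * (t - t\<^sub>0))))"
    have h: "h t\<^sub>0 = 0" "t\<^sub>0 \<le> t \<Longrightarrow> 0 \<le> h t" "h t \<le> q * B" for t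
    proof -
      show "0 \<le> h t" if "t\<^sub>0 \<le> t"
        unfolding h_def using qB \<omega> that by (intro mult_nonneg_nonneg[of "q * B"]) auto
      show "h t \<le> q * B" unfolding h_def using qB by (intro mult_left_le) auto
    qed (simp add: h_def)
    have h': "(h has_real_derivative q * B * \<omega> * exp (- \<omega> * (t - t\<^sub>0))) (at t)" for t
      unfolding h_def by (auto intro!: derivative_eq_intros)
    define P where "P = (\<lambda>t x. q * perturbation t\<^sub>0 t x)"
    have P: "0 \<le> P t x" "P t x \<le> q" for t x
      using perturbation_bounds[of t\<^sub>0 t x] q by (auto simp: P_def intro: mult_left_le)
    define W where "W = (\<lambda>t x. U t (x - \<sigma> * h t))"
    define D where "D = (\<lambda>t x. \<sigma> * W t x + P t x - \<sigma> * v t x)"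
    \<comment> \<open>away from the interface the reaction has the right sign; near it, the drift outweighs the reaction\<close>
    have key: "0 \<le> - (q * B * \<omega> * exp (- \<omega> * (t - t\<^sub>0))) * Ux t (x - \<sigma> * h t) +
        \<sigma> * (f t (W t x) - f t (W t x + \<sigma> * P t x))"
      if t: "t\<^sub>0 \<le> t" for t x
    proof -
      \<comment> \<open>position relative to the interface of the shifted front\<close>
      define y where "y = x - \<sigma> * h t - \<xi> t"
      have W: "W t x = U t (y + \<xi> t)" by (simp add: W_def y_def)
      define d where "d = q * B * \<omega> * exp (- \<omega> * (t - t\<^sub>0))"
      have d: "d > 0" using q B \<omega> by (simp add: d_def)
      have drift: "0 \<le> - d * Ux t (x - \<sigma> * h t)"
        using d Ux_neg[of t "x - \<sigma> * h t"] by (simp add: mult_pos_neg less_imp_le)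
      have \<sigma>h: "- 1 \<le> \<sigma> * h t" using \<sigma> h(2)[OF t] h(3)[of t] qB by auto
      have range: "0 < W t x" "W t x < 1" using solution_range[OF U] by (auto simp: W_def)
      have "0 \<le> - d * Ux t (x - \<sigma> * h t) + \<sigma> * (f t (W t x) - f t (W t x + \<sigma> * P t x))"
      proof (cases "y < - M \<or> M < y")
        case True
        have "0 \<le> \<sigma> * (f t (W t x) - f t (W t x + \<sigma> * P t x))"
        proof (cases "y < - M")
          case True
          then have "1 - \<delta> < W t x" using M(2)[of y t] W by simp
          then have "\<theta>' \<le> W t x" "\<theta>' \<le> W t x - P t x"
            using \<delta>(3) P[of t x] q(2) q0(2) by auto
          moreover have "0 \<le> \<beta> * P t x" using P(1) beta_pos by simp
          ultimately show ?thesis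
            using f_stable[of "W t x" "W t x + P t x" t] f_stable[of "W t x - P t x" "W t x" t] \<sigma> P(1)[of t x]
            by auto
        next
          case False
          then have "W t x < \<delta>" using M(3)[of y t] W True by simp
          then have "W t x + \<sigma> * P t x \<le> \<theta>" "W t x \<le> \<theta>"
            using \<delta>(2) P[of t x] q(2) q0(2) \<sigma> by auto
          then show ?thesis by (simp add: f_zero)
        qed
        then show ?thesis using drift by simp
      next
        case False
        then have "Ux t (x - \<sigma> * h t) < - C" using C(2)[of y t] by (simp add: y_def)
        then have "d * C \<le> d * (- Ux t (x - \<sigma> * h t))" using d by (intro mult_left_mono) auto
        moreover have "L * P t x \<le> d * C"
        proof -
          have "perturbation t\<^sub>0 t x \<le> exp (\<alpha> * (K + M + 1) - \<omega> * (t - t\<^sub>0))"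
          proof -
            have "- \<alpha> * (x - \<xi> t) \<le> \<alpha> * (M + 1)"
            proof -
              have "- (x - \<xi> t) \<le> M + 1" using False \<sigma>h by (simp add: y_def)
              then have "\<alpha> * (- (x - \<xi> t)) \<le> \<alpha> * (M + 1)" using \<alpha> by (intro mult_left_mono) auto
              then show ?thesis by (simp only: mult_minus_left mult_minus_right)
            qed
            then have "- \<alpha> * (x - \<xi> t) + \<alpha> * K - \<alpha> * (c - \<alpha>) * (t - t\<^sub>0) \<le> \<alpha> * (K + M + 1) - \<omega> * (t - t\<^sub>0)"
              by (simp add: \<omega>_def algebra_simps)
            then show ?thesis using perturbation_decay[OF t, of x] by (meson exp_le_cancel_iff order_trans)
          qed
          then have "L * P t x \<le> L * (q * exp (\<alpha> * (K + M + 1) - \<omega> * (t - t\<^sub>0)))"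
            using L_pos q by (simp add: P_def)
          also have "\<dots> = q * (B * \<omega> * C) * exp (- \<omega> * (t - t\<^sub>0))"
            unfolding B(2) by (simp add: algebra_simps flip: exp_add)
          also have "\<dots> = d * C" by (simp add: d_def)
          finally show ?thesis .
        qed
        moreover have "\<bar>f t (W t x) - f t (W t x + \<sigma> * P t x)\<bar> \<le> L * \<bar>W t x - (W t x + \<sigma> * P t x)\<bar>"
          using range P[of t x] q q0(2) \<delta>(2) theta \<sigma> by (intro f_lipschitz) auto
        then have "\<bar>\<sigma> * (f t (W t x) - f t (W t x + \<sigma> * P t x))\<bar> \<le> L * P t x"
          using \<sigma> P(1)[of t x] by (auto simp: abs_mult)
        ultimately show ?thesis by linarith
      qed
      then show ?thesis by (simp add: d_def)
    qed
    have "0 \<le> D t x"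
    proof (rule parabolic_comparison[where D = D and \<Omega> = UNIV and s = t\<^sub>0 and T = t
          and b = 2 and \<Lambda> = L and t = t and x = x])
      show "continuous_on (UNIV \<inter> {t\<^sub>0..t} \<times> UNIV) (\<lambda>(t, x). D t x)"
        unfolding case_prod_beta D_def W_def P_def h_def
        by (intro continuous_intros solution_continuous[OF U] solution_continuous[OF v]
            perturbation_continuous)
      show "- 2 \<le> D t x" for t x
        using \<sigma> P(1)[of t x] solution_range[OF U, of t "x - \<sigma> * h t"] solution_range[OF v, of t x]
        by (auto simp: D_def W_def)
      show "0 \<le> D t\<^sub>0 x" for x
        using init[of x] by (simp add: D_def W_def P_def h(1))
      fix t x assume t: "t\<^sub>0 < t" and neg: "D t x < 0"
      obtain r where r: "0 \<le> r" "heat_op (perturbation t\<^sub>0) t x r" using perturbation_heat_op by blast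
      define d where "d = q * B * \<omega> * exp (- \<omega> * (t - t\<^sub>0))"
      have "((\<lambda>t. \<sigma> * h t) has_real_derivative \<sigma> * d) (at t)"
        unfolding d_def by (intro DERIV_cmult h')
      then have "heat_op D t x (\<sigma> * (f t (W t x) - \<sigma> * d * Ux t (x - \<sigma> * h t)) + q * r - \<sigma> * f t (v t x))"
        unfolding D_def P_def W_def
        by (intro heat_op_diff heat_op_add heat_op_cmult U_moving solution_heat_op v r(2))
      moreover have "L * D t x \<le> \<sigma> * (f t (W t x) - \<sigma> * d * Ux t (x - \<sigma> * h t)) + q * r - \<sigma> * f t (v t x)"
      proof -
        have "\<bar>f t (W t x + \<sigma> * P t x) - f t (v t x)\<bar> \<le> L * \<bar>W t x + \<sigma> * P t x - v t x\<bar>"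
          using solution_range[OF U, of t "x - \<sigma> * h t"] solution_range[OF v, of t x]
            P[of t x] q q0(2) \<delta>(2) theta \<sigma>
          by (intro f_lipschitz) (auto simp: W_def)
        moreover have "W t x + \<sigma> * P t x - v t x = \<sigma> * D t x"
          using \<sigma> by (auto simp: D_def)
        ultimately have "\<bar>f t (W t x + \<sigma> * P t x) - f t (v t x)\<bar> \<le> L * (- D t x)"
          using neg \<sigma> by (auto simp: abs_mult)
        then have "L * D t x \<le> \<sigma> * (f t (W t x + \<sigma> * P t x) - f t (v t x))"
          using \<sigma> by auto
        moreover have "0 \<le> - d * Ux t (x - \<sigma> * h t) + \<sigma> * (f t (W t x) - f t (W t x + \<sigma> * P t x))"
          using key[of t x] t by (simp add: d_def)
        moreover have "0 \<le> q * r" using q r by simp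
        moreover have "\<sigma> * (f t (W t x) - \<sigma> * d * Ux t (x - \<sigma> * h t)) + q * r - \<sigma> * f t (v t x) =
            (- d * Ux t (x - \<sigma> * h t) + \<sigma> * (f t (W t x) - f t (W t x + \<sigma> * P t x))) + q * r +
            \<sigma> * (f t (W t x + \<sigma> * P t x) - f t (v t x))"
          using \<sigma> by (auto simp: algebra_simps)
        ultimately show ?thesis by linarith
      qed
      ultimately show "(t, x) \<in> interior UNIV \<and> (\<exists>r. heat_op D t x r \<and> L * D t x \<le> r)" by auto
    qed (use t in auto)
    moreover have "\<sigma> * W t x \<le> \<sigma> * U t (x - \<sigma> * (q * B))"
      using \<sigma> h(3)[of t] by (auto simp: W_def intro!: U_antimono)
    ultimately show ?thesis by (simp add: D_def P_def)
  qed
  then show ?thesis using q0(1) B(1) by blast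
qed

text \<open>Near any fixed point the perturbation started at \<open>t\<^sub>0\<close> vanishes as \<open>t\<^sub>0\<close> goes to minus infinity. It
  suffices that \<open>t\<^sub>0\<close> does so within a set \<open>S\<close>; this is essential when a favourable situation is known to
  recur but not to persist.\<close>
lemma ancient_comparison:
  assumes le: "\<And>t\<^sub>0. t\<^sub>0 \<in> S \<Longrightarrow> t\<^sub>0 \<le> t \<Longrightarrow> a \<le> b + q * perturbation t\<^sub>0 t x"
    and S: "\<And>s. \<exists>t\<^sub>0\<in>S. t\<^sub>0 \<le> s" and q: "0 < q"
  shows "a \<le> b"
proof (rule field_le_epsilon)
  fix e :: real assume "e > 0"
  have "\<alpha> * (c - \<alpha>) > 0" using \<alpha> by simp
  from exp_decay_backwards[OF this, of "e / q"] \<open>e > 0\<close> q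
  obtain N where N: "\<And>s. s \<le> N \<Longrightarrow> exp (- \<alpha> * (x - \<xi> t) + \<alpha> * K - \<alpha> * (c - \<alpha>) * (t - s)) < e / q \<and> s \<le> t"
    unfolding eventually_at_bot_linorder by (meson divide_pos_pos)
  obtain t\<^sub>0 where t0: "t\<^sub>0 \<in> S" "t\<^sub>0 \<le> N" using S by blast
  have "perturbation t\<^sub>0 t x \<le> e / q"
    using perturbation_decay[of t\<^sub>0 t x] N[OF t0(2)] by linarith
  then have "q * perturbation t\<^sub>0 t x \<le> e" using q by (simp add: field_simps)
  then show "a \<le> b + e" using le[OF t0(1)] N[OF t0(2)] by fastforce
qed

end

section \<open>Squeezing a wave between translates\<close>

lemma has_derivative_from_partials:
  fixes u u_t u_x :: "real \<Rightarrow> real \<Rightarrow> real"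
  assumes ut: "\<And>t x. ((\<lambda>s. u s x) has_real_derivative u_t t x) (at t)"
    and ux: "\<And>t x. (u t has_real_derivative u_x t x) (at x)"
    and cont: "continuous_on UNIV (\<lambda>(t, x). u_x t x)"
  shows "((\<lambda>(t, x). u t x) has_derivative (\<lambda>(a, b). u_t t x * a + u_x t x * b)) (at (t, x))"
proof -
  have "((\<lambda>(t, x). u t x) has_derivative (\<lambda>(a, b). u_t t x * a + blinfun_scaleR_left (u_x t x) b))
      (at (t, x) within UNIV \<times> UNIV)"
  proof (rule has_derivative_partialsI)
    show "((\<lambda>s. u s x) has_derivative (*) (u_t t x)) (at t within UNIV)"
      using ut by (simp add: has_field_derivative_def)
    show "(u s has_derivative blinfun_apply (blinfun_scaleR_left (u_x s y))) (at y within UNIV)" for s y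
      using ux[of s y] by (simp add: has_field_derivative_def mult.commute[of _ "u_x s y"])
    have "continuous_on UNIV (\<lambda>p. blinfun_scaleR_left (u_x (fst p) (snd p)))"
      using cont by (intro bounded_linear.continuous_on[OF bounded_linear_blinfun_scaleR_left])
        (simp add: case_prod_beta)
    then show "continuous (at (t, x) within UNIV \<times> UNIV) (\<lambda>(s, y). blinfun_scaleR_left (u_x s y))"
      unfolding continuous_on_eq_continuous_within split_beta' by simp
  qed auto
  then show ?thesis by (simp add: mult.commute)
qed

context ignition_front_speed
begin

lemma perturbation_initial_lower:
  "min 1 (exp (- \<alpha> * (x - \<xi> t))) / 2 \<le> perturbation t t x"
  using cap_lower[of "exp (- \<alpha> * (x - \<xi> t))"] by (simp add: perturbation_def)

lemma \<xi>_lipschitz: "\<bar>\<xi> t - \<xi> s\<bar> \<le> X * \<bar>t - s\<bar>"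
proof -
  have "norm (\<xi> t - \<xi> s) \<le> X * norm (t - s)"
    by (rule field_differentiable_bound[of UNIV \<xi> \<xi>']) (auto intro: \<xi>_deriv \<xi>'_bound)
  then show ?thesis by simp
qed

text \<open>At every time \<open>t\<close> the wave lies, up to an admissible perturbation, between the translates of
  the front by \<open>\<eta> t - \<xi> t\<close> plus or minus a constant: the exponential tail of each of the two is
  dominated by the perturbation. Shifted comparison propagates this to later times and shows that
  \<open>\<eta> - \<xi>\<close> varies by a bounded amount only. Hence fixed translates serve at all times, and
  starting ever earlier removes the perturbation.\<close>
lemma wave_between_translates:
  assumes v: "solution v" and \<eta>: "interface_location v \<eta>"
    and C: "0 < C" and tail: "\<And>t x. v t x \<le> C * exp (- c * (x - \<eta> t))"
  shows "\<exists>k. \<forall>t x. v t x \<le> U t (x - k) \<and> U t (x + k) \<le> v t x"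
proof -
  obtain q\<^sub>0 B where q0: "q\<^sub>0 > 0" "B > 0" and comparison:
    "\<And>q \<sigma> v t\<^sub>0 t x. 0 < q \<Longrightarrow> q \<le> q\<^sub>0 \<Longrightarrow> \<sigma> = 1 \<or> \<sigma> = -1 \<Longrightarrow> solution v \<Longrightarrow>
     (\<And>x. \<sigma> * v t\<^sub>0 x \<le> \<sigma> * U t\<^sub>0 x + q * perturbation t\<^sub>0 t\<^sub>0 x) \<Longrightarrow> t\<^sub>0 \<le> t \<Longrightarrow>
     \<sigma> * v t x \<le> \<sigma> * U t (x - \<sigma> * (q * B)) + q * perturbation t\<^sub>0 t x"
    using shifted_comparison by blast
  define q where "q = min q\<^sub>0 (1 / 4)"
  have q: "0 < q" "q \<le> q\<^sub>0" "q \<le> 1 / 4" using q0 by (auto simp: q_def)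
  have q2: "q / 2 > 0" using q by simp
  obtain M where M: "M > 0" "\<And>t y. y \<le> - M \<Longrightarrow> 1 - q / 2 < v t (y + \<eta> t)"
    "\<And>t y. M \<le> y \<Longrightarrow> v t (y + \<eta> t) < q / 2"
    using interface_bounds[OF \<eta> q2] by metis
  obtain N where N: "N > 0" "\<And>t y. y \<le> - N \<Longrightarrow> 1 - q / 2 < U t (y + \<xi> t)"
    "\<And>t y. N \<le> y \<Longrightarrow> U t (y + \<xi> t) < q / 2"
    using interface_bounds[OF U_interface q2] by metis
  have half: "q / 2 \<le> q * perturbation t t x" if "x \<le> \<xi> t" for t x
  proof -
    have "0 \<le> \<alpha> * (\<xi> t - x)" using that \<alpha> by simp
    then have "1 \<le> exp (- \<alpha> * (x - \<xi> t))" by (simp add: algebra_simps)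
    then have "q * (1 / 2) \<le> q * perturbation t t x"
      using perturbation_initial_lower[of x t] q by (intro mult_left_mono) auto
    then show ?thesis by simp
  qed
  have tail_lower: "q / 2 * exp (- \<alpha> * (x - \<xi> t)) \<le> q * perturbation t t x" if "\<xi> t \<le> x" for t x
  proof -
    have "exp (- \<alpha> * (x - \<xi> t)) \<le> 1" using that \<alpha> by (simp add: mult_nonneg_nonneg)
    then have "q * (exp (- \<alpha> * (x - \<xi> t)) / 2) \<le> q * perturbation t t x"
      using perturbation_initial_lower[of x t] q by (intro mult_left_mono) auto
    then show ?thesis by simp
  qed
  \<comment> \<open>shift for the upper bound: from distance \<open>H - N\<close> on, the tail of \<open>v\<close> is below \<open>q / 2\<close>\<close>
  define H where "H = N + max 0 (ln (2 * C / q) / c)"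
  have c: "c > 0" using \<alpha> by simp
  have H: "N \<le> H" "C * exp (- c * (H - N)) \<le> q / 2"
  proof -
    have "ln (2 * C / q) \<le> c * (H - N)" using c by (simp add: H_def max_def field_simps)
    then have "exp (- c * (H - N)) \<le> exp (- ln (2 * C / q))" by simp
    also have "\<dots> = q / (2 * C)" using C q by (simp add: exp_minus)
    finally have "C * exp (- c * (H - N)) \<le> C * (q / (2 * C))" using C by (intro mult_left_mono) auto
    then show "C * exp (- c * (H - N)) \<le> q / 2" using C by simp
  qed (simp add: H_def)
  have upper: "1 * v t (x + (\<eta> t - \<xi> t + H')) \<le> 1 * U t x + q * perturbation t t x" if "H \<le> H'" for t x H'
  proof -
    have Upos: "0 < U t x" using solution_range[OF U] by blast
    consider "x - \<xi> t \<le> - N" | "- N < x - \<xi> t" "x \<le> \<xi> t" | "\<xi> t < x" by linarith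
    then show ?thesis
    proof cases
      case 1
      then show ?thesis using N(1) N(2)[of "x - \<xi> t" t] half[of x t]
          solution_range[OF v, of t "x + (\<eta> t - \<xi> t + H')"] by simp
    next
      case 2
      have "v t (x + (\<eta> t - \<xi> t + H')) \<le> C * exp (- c * (x - \<xi> t + H'))"
        using tail[of t "x + (\<eta> t - \<xi> t + H')"] by (simp add: algebra_simps)
      also have "\<dots> \<le> C * exp (- c * (H - N))"
        using 2 that C c by (intro mult_left_mono) auto
      finally show ?thesis using H(2) half[OF 2(2)] Upos by simp
    next
      case 3
      have "v t (x + (\<eta> t - \<xi> t + H')) \<le> C * exp (- c * (x - \<xi> t + H'))"
        using tail[of t "x + (\<eta> t - \<xi> t + H')"] by (simp add: algebra_simps)
      also have "\<dots> \<le> C * (exp (- c * (H - N)) * exp (- \<alpha> * (x - \<xi> t)))"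
      proof -
        have "\<alpha> * (x - \<xi> t) \<le> c * (x - \<xi> t)" using 3 \<alpha> by (intro mult_right_mono) auto
        moreover have "c * (H - N) \<le> c * H'" using c that N(1) by (intro mult_left_mono) auto
        ultimately have "- c * (x - \<xi> t + H') \<le> - c * (H - N) + - \<alpha> * (x - \<xi> t)"
          by (simp add: algebra_simps)
        then show ?thesis using C unfolding exp_add[symmetric] by (intro mult_left_mono) auto
      qed
      also have "\<dots> \<le> q / 2 * exp (- \<alpha> * (x - \<xi> t))"
        unfolding mult.assoc[symmetric] using H(2) by (intro mult_right_mono) auto
      finally show ?thesis using tail_lower[of t x] 3 Upos by simp
    qed
  qed
  \<comment> \<open>beyond \<open>y\<^sub>1\<close> the perturbation dominates the tail of \<open>U\<close>; up to there \<open>v\<close> itself must exceed \<open>\<theta>\<close>\<close>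
  define y\<^sub>1 where "y\<^sub>1 = max 0 (ln (2 / q) / (c\<^sub>0 - \<alpha>))"
  have y1: "0 \<le> y\<^sub>1" "exp (- (c\<^sub>0 - \<alpha>) * y\<^sub>1) \<le> q / 2"
  proof -
    have "ln (2 / q) \<le> (c\<^sub>0 - \<alpha>) * y\<^sub>1" using \<alpha> by (simp add: y\<^sub>1_def max_def field_simps)
    then have "exp (- (c\<^sub>0 - \<alpha>) * y\<^sub>1) \<le> exp (- ln (2 / q))" by (simp add: algebra_simps)
    also have "\<dots> = q / 2" using q by (simp add: exp_minus)
    finally show "exp (- (c\<^sub>0 - \<alpha>) * y\<^sub>1) \<le> q / 2" .
  qed (simp add: y\<^sub>1_def)
  obtain N' where N': "\<And>t y. y \<le> - N' \<Longrightarrow> 1 - min (q / 2) (1 - \<theta>) < v t (y + \<eta> t)"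
    using interface_bounds[OF \<eta>, of "min (q / 2) (1 - \<theta>)"] q2 theta by (metis diff_gt_0_iff_gt less_trans min_less_iff_conj)
  define H\<^sub>2 where "H\<^sub>2 = max 0 N' + y\<^sub>1"
  have lower: "- 1 * v t (x + (\<eta> t - \<xi> t - H')) \<le> - 1 * U t x + q * perturbation t t x" if "H\<^sub>2 \<le> H'" for t x H'
  proof -
    have vpos: "0 < v t (x + (\<eta> t - \<xi> t - H'))" using solution_range[OF v] by blast
    consider "x \<le> \<xi> t" | "\<xi> t < x" "x \<le> \<xi> t + y\<^sub>1" | "\<xi> t + y\<^sub>1 < x" by linarith
    then show ?thesis
    proof cases
      case 1
      then have "1 - min (q / 2) (1 - \<theta>) < v t (x - \<xi> t - H' + \<eta> t)" using that y1(1) by (intro N') (simp add: H\<^sub>2_def)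
      then show ?thesis using half[OF 1] solution_range[OF U, of t x] by (simp add: algebra_simps)
    next
      case 2
      then have "1 - min (q / 2) (1 - \<theta>) < v t (x - \<xi> t - H' + \<eta> t)" using that y1(1) by (intro N') (simp add: H\<^sub>2_def)
      then have "\<theta> < v t (x + (\<eta> t - \<xi> t - H'))" by (simp add: algebra_simps)
      moreover have "U t x \<le> \<theta>" using U_antimono[of "\<xi> t" x t] 2 U_\<xi> by simp
      moreover have "0 \<le> q * perturbation t t x" using q perturbation_bounds by simp
      ultimately show ?thesis by simp
    next
      case 3
      have "U t x \<le> \<theta> * exp (- c\<^sub>0 * (x - \<xi> t))" using U_tail[of "x - \<xi> t" t] 3 y1(1) by simp
      also have "\<dots> \<le> 1 * exp (- c\<^sub>0 * (x - \<xi> t))" using theta by (intro mult_right_mono) auto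
      also have "\<dots> = exp (- (c\<^sub>0 - \<alpha>) * (x - \<xi> t)) * exp (- \<alpha> * (x - \<xi> t))"
        by (simp add: algebra_simps flip: exp_add)
      also have "\<dots> \<le> q / 2 * exp (- \<alpha> * (x - \<xi> t))"
      proof (rule mult_right_mono)
        have "(c\<^sub>0 - \<alpha>) * y\<^sub>1 \<le> (c\<^sub>0 - \<alpha>) * (x - \<xi> t)" using 3 \<alpha> by (intro mult_left_mono) auto
        then have "exp (- (c\<^sub>0 - \<alpha>) * (x - \<xi> t)) \<le> exp (- (c\<^sub>0 - \<alpha>) * y\<^sub>1)"
          by (simp only: exp_le_cancel_iff mult_minus_left neg_le_iff_le)
        then show "exp (- (c\<^sub>0 - \<alpha>) * (x - \<xi> t)) \<le> q / 2" using y1(2) by linarith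
      qed simp
      finally show ?thesis using tail_lower[of t x] 3 y1(1) vpos by simp
    qed
  qed
  define E where "E = M + N + H + H\<^sub>2 + q * B"
  have pos: "0 < q * B" "0 \<le> H\<^sub>2" "0 \<le> H" using q q0 y1 H(1) N(1) by (auto simp: H\<^sub>2_def)
  have drift: "\<bar>(\<eta> t - \<xi> t) - (\<eta> s - \<xi> s)\<bar> \<le> E" if "s \<le> t" for s t
  proof -
    have pq: "q * perturbation s t x \<le> q" for x
      using perturbation_bounds[of s t x] q by (intro mult_left_le) auto
    have "\<eta> t - \<xi> t \<le> \<eta> s - \<xi> s + E"
    proof (rule ccontr)
      assume *: "\<not> ?thesis"
      define x where "x = \<eta> t - M - (\<eta> s - \<xi> s + H)"
      have "1 * v t (x + (\<eta> s - \<xi> s + H)) \<le> 1 * U t (x - 1 * (q * B)) + q * perturbation s t x"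
        by (rule comparison[where t\<^sub>0 = s and \<sigma> = 1]) (use q upper solution_translate[OF v] that in auto)
      moreover have "1 - q / 2 < v t (x + (\<eta> s - \<xi> s + H))" using M(2)[of "- M" t] by (simp add: x_def)
      moreover have "U t (x - q * B) < q / 2"
        using N(3)[of "x - q * B - \<xi> t" t] * pos M(1) by (simp add: x_def E_def)
      ultimately show False using pq[of x] q by simp
    qed
    moreover have "\<eta> s - \<xi> s - E \<le> \<eta> t - \<xi> t"
    proof (rule ccontr)
      assume *: "\<not> ?thesis"
      define x where "x = \<xi> t - N - q * B"
      have "- 1 * v t (x + (\<eta> s - \<xi> s - H\<^sub>2)) \<le> - 1 * U t (x - - 1 * (q * B)) + q * perturbation s t x"
        by (rule comparison[where t\<^sub>0 = s and \<sigma> = "-1"])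
          (use q lower[of H\<^sub>2] solution_translate[OF v] that in auto)
      moreover have "1 - q / 2 < U t (x + q * B)" using N(2)[of "- N" t] by (simp add: x_def)
      ultimately have "1 - 3 * q / 2 < v t (x + (\<eta> s - \<xi> s - H\<^sub>2))" using pq[of x] by simp
      moreover have "v t (x + (\<eta> s - \<xi> s - H\<^sub>2)) < q / 2"
        using M(3)[of "x + (\<eta> s - \<xi> s - H\<^sub>2) - \<eta> t" t] * pos by (simp add: x_def E_def)
      ultimately show False using q by simp
    qed
    ultimately show ?thesis by linarith
  qed
  define d where "d = \<bar>\<eta> 0 - \<xi> 0\<bar> + E"
  have d: "\<bar>\<eta> t - \<xi> t\<bar> \<le> d" for t
    using drift[of 0 t] drift[of t 0] by (cases "0 \<le> t") (auto simp: d_def)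
  have unbounded: "\<exists>t\<^sub>0\<in>UNIV. t\<^sub>0 \<le> s" for s :: real by auto
  have up: "v t (x + (d + H)) \<le> U t (x - q * B)" for t x
  proof (rule ancient_comparison[OF _ unbounded q(1)])
    fix t\<^sub>0 assume "t\<^sub>0 \<le> t"
    have "1 * v t (x + (d + H)) \<le> 1 * U t (x - 1 * (q * B)) + q * perturbation t\<^sub>0 t x"
    proof (rule comparison)
      show "1 * v t\<^sub>0 (x + (d + H)) \<le> 1 * U t\<^sub>0 x + q * perturbation t\<^sub>0 t\<^sub>0 x" for x
        using upper[of "d + H - (\<eta> t\<^sub>0 - \<xi> t\<^sub>0)" t\<^sub>0 x] d[of t\<^sub>0] by simp
    qed (use q solution_translate[OF v] \<open>t\<^sub>0 \<le> t\<close> in auto)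
    then show "v t (x + (d + H)) \<le> U t (x - q * B) + q * perturbation t\<^sub>0 t x" by simp
  qed
  have low: "- v t (x - (d + H\<^sub>2)) \<le> - U t (x + q * B)" for t x
  proof (rule ancient_comparison[OF _ unbounded q(1)])
    fix t\<^sub>0 assume "t\<^sub>0 \<le> t"
    have "- 1 * v t (x + - (d + H\<^sub>2)) \<le> - 1 * U t (x - - 1 * (q * B)) + q * perturbation t\<^sub>0 t x"
    proof (rule comparison)
      show "- 1 * v t\<^sub>0 (x + - (d + H\<^sub>2)) \<le> - 1 * U t\<^sub>0 x + q * perturbation t\<^sub>0 t\<^sub>0 x" for x
      proof -
        have "H\<^sub>2 \<le> d + H\<^sub>2 + (\<eta> t\<^sub>0 - \<xi> t\<^sub>0)" using d[of t\<^sub>0] by linarith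
        moreover have "\<eta> t\<^sub>0 - \<xi> t\<^sub>0 - (d + H\<^sub>2 + (\<eta> t\<^sub>0 - \<xi> t\<^sub>0)) = - (d + H\<^sub>2)" by simp
        ultimately show ?thesis using lower[of "d + H\<^sub>2 + (\<eta> t\<^sub>0 - \<xi> t\<^sub>0)" t\<^sub>0 x] by metis
      qed
    qed (use q solution_translate[OF v] \<open>t\<^sub>0 \<le> t\<close> in auto)
    then show "- v t (x - (d + H\<^sub>2)) \<le> - U t (x + q * B) + q * perturbation t\<^sub>0 t x"
      by (simp add: algebra_simps)
  qed
  define k where "k = d + H + H\<^sub>2 + q * B"
  have "v t x \<le> U t (x - k) \<and> U t (x + k) \<le> v t x" for t x
  proof
    have "v t x \<le> U t (x - (d + H) - q * B)" using up[of t "x - (d + H)"] by simp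
    also have "\<dots> \<le> U t (x - k)" using pos by (intro U_antimono) (simp add: k_def)
    finally show "v t x \<le> U t (x - k)" .
    have "U t (x + k) \<le> U t (x + (d + H\<^sub>2) + q * B)" using pos by (intro U_antimono) (simp add: k_def)
    also have "\<dots> \<le> v t x" using low[of t "x + (d + H\<^sub>2)"] by simp
    finally show "U t (x + k) \<le> v t x" .
  qed
  then show ?thesis by blast
qed

text \<open>If \<open>v\<close> is bounded by a translate of the front and the two are \<open>\<kappa>\<close> apart near the interface at arbitrarily early
  times, then the translate can be moved closer. One time unit after each such time, the
  gap is at least \<open>\<kappa>'\<close> on a large window, so moving the translate by a small \<open>e\<close> preserves the order
  there. Outside the window the order is violated by at most an increment of the front,
  which is \<open>e\<close> times something exponentially small and hence an admissible perturbation with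
  \<open>q = e / (2 B)\<close>. Shifted comparison gives back \<open>q B = e / 2\<close>, a net gain of \<open>e / 2\<close>.\<close>
lemma shift_improvement:
  assumes v: "solution v" and \<sigma>: "\<sigma> = 1 \<or> \<sigma> = -1"
    and le: "\<And>t x. \<sigma> * v t x \<le> \<sigma> * U t (x - \<sigma> * k)"
    and \<kappa>: "\<kappa> > 0" and S: "\<And>s. \<exists>t\<^sub>0\<in>S. t\<^sub>0 \<le> s"
    and gap: "\<And>t\<^sub>0. t\<^sub>0 \<in> S \<Longrightarrow>
      \<exists>x\<^sub>0. \<bar>x\<^sub>0 - \<xi> t\<^sub>0\<bar> \<le> R \<and> \<kappa> \<le> \<sigma> * (U t\<^sub>0 (x\<^sub>0 - \<sigma> * k) - v t\<^sub>0 x\<^sub>0)"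
  shows "\<exists>k'<k. \<forall>t x. \<sigma> * v t x \<le> \<sigma> * U t (x - \<sigma> * k')"
proof -
  obtain q\<^sub>0 B where q0: "q\<^sub>0 > 0" "B > 0" and comparison:
    "\<And>q v t\<^sub>0 t x. 0 < q \<Longrightarrow> q \<le> q\<^sub>0 \<Longrightarrow> solution v \<Longrightarrow>
     (\<And>x. \<sigma> * v t\<^sub>0 x \<le> \<sigma> * U t\<^sub>0 x + q * perturbation t\<^sub>0 t\<^sub>0 x) \<Longrightarrow> t\<^sub>0 \<le> t \<Longrightarrow>
     \<sigma> * v t x \<le> \<sigma> * U t (x - \<sigma> * (q * B)) + q * perturbation t\<^sub>0 t x"
    using shifted_comparison \<sigma> by metis
  obtain A \<nu> where A: "A > 0" "\<nu> > 0"
    and left: "\<And>e t x. 0 \<le> e \<Longrightarrow> U t (x - e) - U t x \<le> A * e * exp (\<nu> * (x - \<xi> t))"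
    using U_increment_left by blast
  define b where "b = 1 / (4 * B)"
  have b: "b > 0" using q0 by (simp add: b_def)
  have "\<forall>\<^sub>F M in at_top. A * exp (\<nu> * (1 - M)) < b \<and> C\<^sub>0 * exp c\<^sub>0 * exp (- (c\<^sub>0 - \<alpha>) * M) < b \<and> 1 \<le> M"
  proof (intro eventually_conj eventually_ge_at_top)
    have "((\<lambda>M. A * exp (\<nu> * (1 - M))) \<longlongrightarrow> 0) at_top" using A(2) by real_asymp
    then show "\<forall>\<^sub>F M in at_top. A * exp (\<nu> * (1 - M)) < b" using b by (rule order_tendstoD)
    define \<gamma> where "\<gamma> = c\<^sub>0 - \<alpha>"
    have "\<gamma> > 0" using \<alpha> by (simp add: \<gamma>_def)
    then have "((\<lambda>M. C\<^sub>0 * exp c\<^sub>0 * exp (- \<gamma> * M)) \<longlongrightarrow> 0) at_top" by real_asymp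
    then show "\<forall>\<^sub>F M in at_top. C\<^sub>0 * exp c\<^sub>0 * exp (- (c\<^sub>0 - \<alpha>) * M) < b"
      using b unfolding \<gamma>_def by (rule order_tendstoD)
  qed
  then obtain M where M: "A * exp (\<nu> * (1 - M)) < b" "C\<^sub>0 * exp c\<^sub>0 * exp (- (c\<^sub>0 - \<alpha>) * M) < b" "1 \<le> M"
    using eventually_happens[of _ "at_top :: real filter"] by auto
  define A\<^sub>1 where "A\<^sub>1 = 1 + L / 2"
  have A1: "A\<^sub>1 > 0" using L_pos by (simp add: A\<^sub>1_def)
  obtain \<kappa>' where \<kappa>': "\<kappa>' > 0" and spread: "\<And>v\<^sub>1 v\<^sub>2 t\<^sub>0 x\<^sub>0 x. solution v\<^sub>1 \<Longrightarrow> solution v\<^sub>2 \<Longrightarrow>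
     (\<And>t x. v\<^sub>2 t x \<le> v\<^sub>1 t x) \<Longrightarrow> \<kappa> \<le> v\<^sub>1 t\<^sub>0 x\<^sub>0 - v\<^sub>2 t\<^sub>0 x\<^sub>0 \<Longrightarrow> \<bar>x - x\<^sub>0\<bar> \<le> M + X + \<bar>k\<bar> + 1 + R \<Longrightarrow>
     \<kappa>' \<le> v\<^sub>1 (t\<^sub>0 + 1) x - v\<^sub>2 (t\<^sub>0 + 1) x"
    using positivity_spreads[OF \<kappa>, of "M + X + \<bar>k\<bar> + 1 + R"] by metis
  \<comment> \<open>small enough for the gap on the window to survive and for \<open>q\<close> to be admissible\<close>
  define e where "e = min 1 (min (\<kappa>' / A\<^sub>1) (2 * B * q\<^sub>0))"
  have e: "0 < e" "e \<le> 1" "e \<le> \<kappa>' / A\<^sub>1" "e \<le> 2 * B * q\<^sub>0"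
    using \<kappa>' A1 q0 by (auto simp: e_def)
  have eA: "A\<^sub>1 * e \<le> \<kappa>'" using e(3) A1 by (simp add: field_simps)
  define q where "q = e / (2 * B)"
  have q: "0 < q" "q \<le> q\<^sub>0" "q * B = e / 2" "e * b = q / 2"
    using e q0 by (auto simp: q_def b_def field_simps)
  have step: "\<sigma> * v (t + 1) (x + \<sigma> * (k - e)) \<le> \<sigma> * U (t + 1) x + q * perturbation (t + 1) (t + 1) x"
    if "t \<in> S" for t x
  proof -
    obtain x\<^sub>0 where x0: "\<bar>x\<^sub>0 - \<xi> t\<bar> \<le> R" "\<kappa> \<le> \<sigma> * (U t (x\<^sub>0 - \<sigma> * k) - v t x\<^sub>0)"
      using gap[OF \<open>t \<in> S\<close>] by blast
    define t\<^sub>1 where "t\<^sub>1 = t + 1"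
    \<comment> \<open>right end point of the interval over which the increment is taken\<close>
    define z where "z = (if \<sigma> = 1 then x else x + e)"
    have z: "\<sigma> * U t\<^sub>1 (x - \<sigma> * e) - \<sigma> * U t\<^sub>1 x = U t\<^sub>1 (z - e) - U t\<^sub>1 z" "x \<le> z" "z \<le> x + e"
      using \<sigma> e by (auto simp: z_def)
    have le': "\<sigma> * v t\<^sub>1 (x + \<sigma> * (k - e)) \<le> \<sigma> * U t\<^sub>1 (x - \<sigma> * e)"
      using le[of t\<^sub>1 "x + \<sigma> * (k - e)"] by (simp add: algebra_simps)
    have pert: "q * (min 1 (exp (- \<alpha> * (x - \<xi> t\<^sub>1))) / 2) \<le> q * perturbation t\<^sub>1 t\<^sub>1 x"
      using perturbation_initial_lower q by (intro mult_left_mono) auto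
    consider "\<bar>x - \<xi> t\<^sub>1\<bar> \<le> M" | "x < \<xi> t\<^sub>1 - M" | "\<xi> t\<^sub>1 + M < x" by linarith
    then show ?thesis
    proof cases
      case 1
      have "\<bar>\<xi> t\<^sub>1 - \<xi> t\<bar> \<le> X" using \<xi>_lipschitz[of t\<^sub>1 t] by (simp add: t\<^sub>1_def)
      moreover have "\<bar>\<sigma> * (k - e)\<bar> \<le> \<bar>k\<bar> + 1" using \<sigma> e by auto
      ultimately have near: "\<bar>x + \<sigma> * (k - e) - x\<^sub>0\<bar> \<le> M + X + \<bar>k\<bar> + 1 + R" using 1 x0(1) by linarith
      have "\<kappa>' \<le> \<sigma> * (U t\<^sub>1 (x + \<sigma> * (k - e) - \<sigma> * k) - v t\<^sub>1 (x + \<sigma> * (k - e)))"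
        using \<sigma>
      proof
        assume \<sigma>1: "\<sigma> = 1"
        have "\<kappa>' \<le> U (t + 1) (x + \<sigma> * (k - e) + - k) - v (t + 1) (x + \<sigma> * (k - e))"
          using near x0(2) le \<sigma>1 by (intro spread[OF solution_translate[OF U, of "- k"] v]) auto
        then show ?thesis by (simp add: \<sigma>1 t\<^sub>1_def)
      next
        assume \<sigma>1: "\<sigma> = -1"
        have "\<kappa>' \<le> v (t + 1) (x + \<sigma> * (k - e)) - U (t + 1) (x + \<sigma> * (k - e) + k)"
          using near x0(2) le \<sigma>1 by (intro spread[OF v solution_translate[OF U, of k]]) auto
        then show ?thesis by (simp add: \<sigma>1 t\<^sub>1_def)
      qed
      then have "\<sigma> * v t\<^sub>1 (x + \<sigma> * (k - e)) \<le> \<sigma> * U t\<^sub>1 (x - \<sigma> * e) - \<kappa>'"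
        by (simp add: algebra_simps)
      moreover have "U t\<^sub>1 (z - e) - U t\<^sub>1 z \<le> A\<^sub>1 * e"
        using solution_lipschitz[OF U, of t\<^sub>1 "z - e" z] e by (simp add: A\<^sub>1_def)
      moreover have "0 \<le> q * perturbation t\<^sub>1 t\<^sub>1 x" using q perturbation_bounds by simp
      ultimately show ?thesis using z(1) eA unfolding t\<^sub>1_def by linarith
    next
      case 2
      have "exp (\<nu> * (z - \<xi> t\<^sub>1)) \<le> exp (\<nu> * (1 - M))"
        using 2 z(3) e A(2) by simp
      then have "A * e * exp (\<nu> * (z - \<xi> t\<^sub>1)) \<le> A * e * exp (\<nu> * (1 - M))"
        using A(1) e by (intro mult_left_mono) auto
      also have "\<dots> = e * (A * exp (\<nu> * (1 - M)))" by simp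
      also have "\<dots> \<le> e * b" using M(1) e by (intro mult_left_mono) auto
      finally have "U t\<^sub>1 (z - e) - U t\<^sub>1 z \<le> q / 2" using left[of e t\<^sub>1 z] e q(4) by simp
      moreover have "min 1 (exp (- \<alpha> * (x - \<xi> t\<^sub>1))) = 1"
      proof -
        have "0 \<le> \<alpha> * (\<xi> t\<^sub>1 - x)" using 2 M(3) \<alpha> by simp
        then show ?thesis by (simp add: algebra_simps)
      qed
      ultimately show ?thesis using z(1) le' pert unfolding t\<^sub>1_def by simp
    next
      case 3
      have "C\<^sub>0 * exp (- c\<^sub>0 * (z - e - \<xi> t\<^sub>1)) \<le> C\<^sub>0 * (exp c\<^sub>0 * exp (- (c\<^sub>0 - \<alpha>) * M) * exp (- \<alpha> * (x - \<xi> t\<^sub>1)))"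
      proof -
        have "c\<^sub>0 * (x - 1 - \<xi> t\<^sub>1) \<le> c\<^sub>0 * (z - e - \<xi> t\<^sub>1)"
          using z(2) e c0_pos by (intro mult_left_mono) auto
        moreover have "(c\<^sub>0 - \<alpha>) * M \<le> (c\<^sub>0 - \<alpha>) * (x - \<xi> t\<^sub>1)" using 3 \<alpha> by (intro mult_left_mono) auto
        ultimately have "- c\<^sub>0 * (z - e - \<xi> t\<^sub>1) \<le> c\<^sub>0 + - (c\<^sub>0 - \<alpha>) * M + - \<alpha> * (x - \<xi> t\<^sub>1)"
          by (simp add: algebra_simps)
        then show ?thesis unfolding exp_add[symmetric] using C0_pos by (intro mult_left_mono) auto
      qed
      also have "\<dots> = (C\<^sub>0 * exp c\<^sub>0 * exp (- (c\<^sub>0 - \<alpha>) * M)) * exp (- \<alpha> * (x - \<xi> t\<^sub>1))" by simp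
      also have "\<dots> \<le> b * exp (- \<alpha> * (x - \<xi> t\<^sub>1))" using M(2) by (intro mult_right_mono) auto
      finally have "e * (C\<^sub>0 * exp (- c\<^sub>0 * (z - e - \<xi> t\<^sub>1))) \<le> e * (b * exp (- \<alpha> * (x - \<xi> t\<^sub>1)))"
        using e by (intro mult_left_mono) auto
      also have "\<dots> = q / 2 * exp (- \<alpha> * (x - \<xi> t\<^sub>1))" using q(4) by (simp flip: mult.assoc)
      finally have "U t\<^sub>1 (z - e) - U t\<^sub>1 z \<le> q / 2 * exp (- \<alpha> * (x - \<xi> t\<^sub>1))"
        using U_increment_right[of e t\<^sub>1 z] 3 M(3) z(2) e by simp
      moreover have "min 1 (exp (- \<alpha> * (x - \<xi> t\<^sub>1))) = exp (- \<alpha> * (x - \<xi> t\<^sub>1))"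
      proof -
        have "0 < \<alpha> * (x - \<xi> t\<^sub>1)" using 3 M(3) \<alpha> by (intro mult_pos_pos) auto
        then show ?thesis by simp
      qed
      ultimately show ?thesis using z(1) le' pert unfolding t\<^sub>1_def by simp
    qed
  qed
  have improved: "\<sigma> * v t (x + \<sigma> * (k - e)) \<le> \<sigma> * U t (x - \<sigma> * (q * B))" for t x
  proof (rule ancient_comparison[where S = "(\<lambda>t. t + 1) ` S", OF _ _ q(1)])
    show "\<exists>t\<^sub>0\<in>(\<lambda>t. t + 1) ` S. t\<^sub>0 \<le> s" for s
      using S[of "s - 1"] by force
    fix t\<^sub>0 assume "t\<^sub>0 \<in> (\<lambda>t. t + 1) ` S" "t\<^sub>0 \<le> t"
    then show "\<sigma> * v t (x + \<sigma> * (k - e)) \<le> \<sigma> * U t (x - \<sigma> * (q * B)) + q * perturbation t\<^sub>0 t x"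
      by (intro comparison[OF q(1,2) solution_translate[OF v]]) (auto simp: step)
  qed
  have "\<sigma> * v t x \<le> \<sigma> * U t (x - \<sigma> * (k - e / 2))" for t x
  proof -
    have "x - \<sigma> * (k - e) - \<sigma> * (q * B) = x - \<sigma> * (k - e / 2)"
      unfolding q(3) by (simp add: algebra_simps)
    with improved[of t "x - \<sigma> * (k - e)"] show ?thesis by simp
  qed
  moreover have "k - e / 2 < k" using e by simp
  ultimately show ?thesis by blast
qed

text \<open>The optimal translate is attained, because the admissible shifts form a closed set.\<close>
lemma minimal_shift:
  assumes \<sigma>: "\<sigma> = 1 \<or> \<sigma> = -1" and ex: "\<forall>t x. \<sigma> * v t x \<le> \<sigma> * U t (x - \<sigma> * k\<^sub>0)"
    and below: "\<And>k. \<forall>t x. \<sigma> * v t x \<le> \<sigma> * U t (x - \<sigma> * k) \<Longrightarrow> m \<le> k"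
  obtains k where "\<And>t x. \<sigma> * v t x \<le> \<sigma> * U t (x - \<sigma> * k)"
    and "\<And>k'. \<forall>t x. \<sigma> * v t x \<le> \<sigma> * U t (x - \<sigma> * k') \<Longrightarrow> k \<le> k'"
proof -
  define S where "S = {k. \<forall>t x. \<sigma> * v t x \<le> \<sigma> * U t (x - \<sigma> * k)}"
  have "S = (\<Inter>t. \<Inter>x. {k. \<sigma> * v t x \<le> \<sigma> * U t (x - \<sigma> * k)})" by (auto simp: S_def)
  moreover have "closed {k. \<sigma> * v t x \<le> \<sigma> * U t (x - \<sigma> * k)}" for t x
    by (intro closed_Collect_le continuous_intros solution_continuous[OF U])
  ultimately have "closed S" by (auto intro!: closed_INT)
  moreover have bdd: "bdd_below S" using below by (auto simp: S_def intro!: bdd_belowI[of _ m])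
  moreover have "S \<noteq> {}" using ex by (auto simp: S_def)
  ultimately have "Inf S \<in> S" by (intro closed_contains_Inf)
  then show thesis using bdd by (intro that[of "Inf S"]) (auto simp: S_def intro!: cInf_lower)
qed

text \<open>Let \<open>a\<close> and \<open>b\<close> be the optimal shifts from above and below. If \<open>a + b > 0\<close>, the two translates are
  \<open>2 \<kappa>\<close> apart at the interface of the upper one, uniformly in time, so at each time \<open>v\<close> is \<open>\<kappa>\<close> away
  from one of them. One of the two cases occurs at arbitrarily early times, and then the
  corresponding shift can be improved. Hence \<open>a + b = 0\<close> and \<open>v\<close> equals the translate.\<close>
lemma wave_is_translate:
  assumes v: "solution v" and \<eta>: "interface_location v \<eta>"
    and C: "0 < C" and tail: "\<And>t x. v t x \<le> C * exp (- c * (x - \<eta> t))"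
  shows "\<exists>\<zeta>. \<forall>t x. v t x = U t (x + \<zeta>)"
proof -
  obtain k\<^sub>0 where k0: "\<And>t x. v t x \<le> U t (x - k\<^sub>0)" "\<And>t x. U t (x + k\<^sub>0) \<le> v t x"
    using wave_between_translates[OF assms] by blast
  have order: "y \<le> x" if "U t x \<le> U t y" for t x y
    using U_strict_antimono[of x y t] that by (meson not_le)
  obtain a where a: "\<And>t x. 1 * v t x \<le> 1 * U t (x - 1 * a)"
    "\<And>a'. \<forall>t x. 1 * v t x \<le> 1 * U t (x - 1 * a') \<Longrightarrow> a \<le> a'"
  proof (rule minimal_shift[of 1 v k\<^sub>0 "- k\<^sub>0"])
    fix k assume "\<forall>t x. 1 * v t x \<le> 1 * U t (x - 1 * k)"
    then have "U 0 (0 + k\<^sub>0) \<le> U 0 (0 - k)" using k0(2)[of 0 0] by (metis mult_1 order_trans)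
    then show "- k\<^sub>0 \<le> k" using order[of 0 "0 + k\<^sub>0" "0 - k"] by simp
  qed (use k0 in auto)
  obtain b where b: "\<And>t x. - 1 * v t x \<le> - 1 * U t (x - - 1 * b)"
    "\<And>b'. \<forall>t x. - 1 * v t x \<le> - 1 * U t (x - - 1 * b') \<Longrightarrow> b \<le> b'"
  proof (rule minimal_shift[of "- 1" v k\<^sub>0 "- k\<^sub>0"])
    fix k assume "\<forall>t x. - 1 * v t x \<le> - 1 * U t (x - - 1 * k)"
    then have "- 1 * v 0 0 \<le> - 1 * U 0 (0 - - 1 * k)" by blast
    then have "U 0 (0 + k) \<le> U 0 (0 - k\<^sub>0)" using k0(1)[of 0 0] by simp
    then show "- k\<^sub>0 \<le> k" using order[of 0 "0 + k" "0 - k\<^sub>0"] by simp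
  qed (use k0 in auto)
  have va: "v t x \<le> U t (x - a)" and vb: "U t (x + b) \<le> v t x" for t x
    using a(1)[of t x] b(1)[of t x] by auto
  have "0 \<le> a + b"
    using order[of 0 "0 + b" "0 - a"] va[of 0 0] vb[of 0 0] by simp
  moreover have "\<not> 0 < a + b"
  proof
    assume pos: "0 < a + b"
    define \<kappa> where "\<kappa> = (\<theta> - \<theta> * exp (- c\<^sub>0 * (a + b))) / 2"
    have "exp (- c\<^sub>0 * (a + b)) < 1" using pos c0_pos by (simp add: mult_pos_pos)
    then have "\<theta> * exp (- c\<^sub>0 * (a + b)) < \<theta>" using theta by simp
    then have \<kappa>: "\<kappa> > 0" by (simp add: \<kappa>_def)
    define S\<^sub>1 where "S\<^sub>1 = {t. \<kappa> \<le> U t (\<xi> t + a - a) - v t (\<xi> t + a)}"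
    define S\<^sub>2 where "S\<^sub>2 = {t. \<kappa> \<le> v t (\<xi> t + a) - U t (\<xi> t + a + b)}"
    have cover: "t \<in> S\<^sub>1 \<or> t \<in> S\<^sub>2" for t
    proof -
      have "U t (\<xi> t + a + b) \<le> \<theta> * exp (- c\<^sub>0 * (a + b))"
        using U_tail[of "a + b" t] pos by (simp add: add_ac)
      then have "2 * \<kappa> \<le> U t (\<xi> t + a - a) - U t (\<xi> t + a + b)"
        using U_\<xi>[of t] by (simp add: \<kappa>_def)
      then show ?thesis by (auto simp: S\<^sub>1_def S\<^sub>2_def)
    qed
    show False
    proof (cases "\<forall>s. \<exists>t\<^sub>0\<in>S\<^sub>1. t\<^sub>0 \<le> s")
      case True
      have "\<exists>k'<a. \<forall>t x. 1 * v t x \<le> 1 * U t (x - 1 * k')"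
        using True by (intro shift_improvement[OF v _ a(1) \<kappa>, of S\<^sub>1 "\<bar>a\<bar>"])
          (auto simp: S\<^sub>1_def intro!: exI[of _ "\<xi> _ + a"])
      then show False using a(2) by force
    next
      case False
      then obtain s where s: "\<And>t. t \<le> s \<Longrightarrow> t \<in> S\<^sub>2" using cover by blast
      have "\<exists>t\<^sub>0\<in>S\<^sub>2. t\<^sub>0 \<le> r" for r using s[of "min r s"] by (intro bexI[of _ "min r s"]) auto
      then have "\<exists>k'<b. \<forall>t x. - 1 * v t x \<le> - 1 * U t (x - - 1 * k')"
        by (intro shift_improvement[OF v _ b(1) \<kappa>, of S\<^sub>2 "\<bar>a\<bar>"])
          (auto simp: S\<^sub>2_def intro!: exI[of _ "\<xi> _ + a"])
      then show False using b(2) by force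
    qed
  qed
  ultimately have "b = - a" by simp
  then have "v t x = U t (x + - a)" for t x
    using va[of t x] vb[of t x] by simp
  then show ?thesis by blast
qed

end


section \<open>From the hypotheses on the nonlinearity to uniqueness\<close>

text \<open>The lower bound \<open>f_inf\<close> makes the reaction uniformly positive on compact subsets of
  \<open>(\<theta>, 1)\<close>, and the mean value theorem turns the bound on \<open>f_u\<close> into decay of differences.\<close>
lemma ignition_from_hypotheses:
  assumes "H1 f \<theta>" and "H2 f \<theta>" and "H3 f \<theta>"
  obtains \<theta>' \<beta> L where "ignition f \<theta> \<theta>' \<beta> L"
proof -
  have \<theta>: "0 < \<theta>" "\<theta> < 1" and zero: "\<And>t u. u \<le> \<theta> \<Longrightarrow> f t u = 0" and one: "\<And>t. f t 1 = 0"
    and pos: "\<And>t u. \<theta> < u \<Longrightarrow> u < 1 \<Longrightarrow> 0 < f t u"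
    and lip: "loc_unif_lipschitz f" and C1: "\<And>t. C1_within {\<theta>..} (f t)"
    using assms(1) unfolding H1_def by auto
  obtain \<theta>' \<beta> where \<theta>': "\<theta> < \<theta>'" "\<theta>' < 1" and \<beta>: "0 < \<beta>"
    and decr: "\<And>t u. \<theta>' \<le> u \<Longrightarrow> deriv (f t) u \<le> - \<beta>"
    using assms(3) unfolding H3_def by auto
  obtain L where L: "\<And>t. L-lipschitz_on {-1..2} (f t)"
    using lip unfolding loc_unif_lipschitz_def by (meson compact_Icc)
  obtain f_inf L' where f_inf: "L'-lipschitz_on {0..} f_inf" "\<And>u. \<theta> < u \<Longrightarrow> u < 1 \<Longrightarrow> 0 < f_inf u"
    "\<And>t u. \<theta> \<le> u \<Longrightarrow> u \<le> 1 \<Longrightarrow> f_inf u \<le> f t u"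
    using assms(2) unfolding H2_def by (metis atLeastAtMost_iff greaterThanLessThan_iff)
  have "L \<ge> 0" using L lipschitz_on_nonneg by blast
  have "ignition f \<theta> \<theta>' \<beta> (L + 1)"
  proof
    show "0 \<le> f t u" if "u \<le> 1" for t u
      using that zero[of u t] pos[of u t] one[of t] by (cases "u \<le> \<theta>"; cases "u = 1") auto
    show "\<bar>f t u - f t v\<bar> \<le> (L + 1) * \<bar>u - v\<bar>" if "u \<in> {-1..2}" "v \<in> {-1..2}" for u v t
      using lipschitz_onD[OF L that, of t] by (simp add: dist_real_def distrib_right)
    show "f t v \<le> f t u - \<beta> * (v - u)" if "\<theta>' \<le> u" "u \<le> v" for u v t
    proof (cases "u = v")
      case False
      obtain g where g: "\<And>z. \<theta> \<le> z \<Longrightarrow> (f t has_real_derivative g z) (at z within {\<theta>..})"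
        using C1[of t] unfolding C1_within_def by auto
      have g': "(f t has_real_derivative g z) (at z)" if "\<theta> < z" for z
      proof -
        have "at z within {\<theta>..} = at z" using that by (intro at_within_interior) (simp add: interior_real_atLeast)
        then show ?thesis using g[of z] that by simp
      qed
      have "\<exists>z>u. z < v \<and> f t v - f t u = (v - u) * g z"
        using that \<theta>' False by (intro MVT2) (auto intro!: g')
      then obtain z where z: "u < z" "z < v" "f t v - f t u = (v - u) * g z" by blast
      have "g z \<le> - \<beta>" using decr[of z t] DERIV_imp_deriv[OF g'[of z]] z that \<theta>' by simp
      then have "(v - u) * g z \<le> (v - u) * - \<beta>" using that by (intro mult_left_mono) auto
      then show ?thesis using z(3) by (simp add: algebra_simps)
    qed simp
    show "\<exists>m>0. \<forall>t. \<forall>u\<in>{a..b}. m \<le> f t u" if "\<theta> < a" "b < 1" for a b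
    proof (cases "a \<le> b")
      case True
      have "continuous_on {a..b} f_inf"
        using lipschitz_on_continuous_on[OF f_inf(1)] by (rule continuous_on_subset) (use that \<theta> in auto)
      then obtain z where z: "z \<in> {a..b}" "\<And>u. u \<in> {a..b} \<Longrightarrow> f_inf z \<le> f_inf u"
        using continuous_attains_inf[of "{a..b}" f_inf] True by auto
      have "f_inf z \<le> f t u" if "u \<in> {a..b}" for t u
        using z(2)[OF that] f_inf(3)[of u t] that \<open>\<theta> < a\<close> \<open>b < 1\<close> by auto
      moreover have "0 < f_inf z" using f_inf(2)[of z] z(1) that by auto
      ultimately show ?thesis by blast
    qed (auto intro: zero_less_one)
  qed (use \<theta> \<theta>' \<beta> zero \<open>L \<ge> 0\<close> in auto)
  then show thesis by (rule that)
qed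

context ignition
begin

lemma solution_of_classical:
  assumes "entire_classical_solution f u" and range: "\<And>t x. 0 < u t x \<and> u t x < 1"
  shows "solution u"
proof -
  obtain u_t u_x u_xx where ut: "\<And>t x. ((\<lambda>s. u s x) has_real_derivative u_t t x) (at t)"
    and ux: "\<And>t x. (u t has_real_derivative u_x t x) (at x)"
    and uxx: "\<And>t x. (u_x t has_real_derivative u_xx t x) (at x)"
    and eq: "\<And>t x. u_t t x = u_xx t x + f t (u t x)"
    and cont: "continuous_on UNIV (\<lambda>(t, x). u_x t x)"
    using assms(1) unfolding entire_classical_solution_def by blast
  have "continuous_on UNIV (\<lambda>(t, x). u t x)"
    using has_derivative_from_partials[OF ut ux cont]
    by (auto intro!: continuous_at_imp_continuous_on has_derivative_continuous)
  moreover have "heat_op u t x (f t (u t x))" for t x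
    by (rule heat_opI[OF ut ux uxx]) (simp add: eq)
  ultimately show ?thesis using range by (simp add: solution_def)
qed

lemma solution_of_wave:
  "generalized_traveling_wave f u \<Longrightarrow> solution u"
  unfolding generalized_traveling_wave_def by (intro solution_of_classical) auto

lemma moving_frame_heat_op:
  assumes "entire_classical_solution f u" and h: "(h has_real_derivative h') (at t)"
  shows "heat_op (\<lambda>t x. u t (x - h t)) t x (f t (u t (x - h t)) - h' * deriv (u t) (x - h t))"
proof -
  obtain u_t u_x u_xx where ut: "\<And>t x. ((\<lambda>s. u s x) has_real_derivative u_t t x) (at t)"
    and ux: "\<And>t x. (u t has_real_derivative u_x t x) (at x)"
    and uxx: "\<And>t x. (u_x t has_real_derivative u_xx t x) (at x)"
    and eq: "\<And>t x. u_t t x = u_xx t x + f t (u t x)"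
    and cont: "continuous_on UNIV (\<lambda>(t, x). u_x t x)"
    using assms(1) unfolding entire_classical_solution_def by blast
  have shift: "((\<lambda>y. y - h t) has_real_derivative 1) (at y)" for y
    by (auto intro!: derivative_eq_intros)
  show ?thesis
  proof (rule heat_opI)
    have "((\<lambda>s. (s, x - h s)) has_derivative (\<lambda>a. (a, - h' * a))) (at t)"
      using h unfolding has_field_derivative_def
      by (auto intro!: derivative_eq_intros simp: fun_eq_iff)
    from has_derivative_compose[OF this has_derivative_from_partials[OF ut ux cont, of t "x - h t"]]
    have "((\<lambda>s. u s (x - h s)) has_derivative
        (\<lambda>a. u_t t (x - h t) * a + u_x t (x - h t) * (- h' * a))) (at t)" by simp
    then show "((\<lambda>s. u s (x - h s)) has_real_derivative u_t t (x - h t) - h' * u_x t (x - h t)) (at t)"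
      unfolding has_field_derivative_def
      by (rule has_derivative_eq_rhs) (simp add: fun_eq_iff algebra_simps)
    show "((\<lambda>y. u t (y - h t)) has_real_derivative u_x t (y - h t)) (at y)" for y
      using DERIV_chain2[OF ux[of t "y - h t"] shift] by simp
    show "((\<lambda>y. u_x t (y - h t)) has_real_derivative u_xx t (x - h t)) (at x)"
      using DERIV_chain2[OF uxx[of t "x - h t"] shift] by simp
    show "f t (u t (x - h t)) - h' * deriv (u t) (x - h t) =
        u_t t (x - h t) - h' * u_x t (x - h t) - u_xx t (x - h t)"
      using DERIV_imp_deriv[OF ux] by (simp add: eq)
  qed
qed

lemma front_of_reference_wave:
  assumes "reference_wave f \<theta> u \<xi>"
  obtains c\<^sub>0 C\<^sub>0 X where "ignition_front f \<theta> \<theta>' \<beta> L u (\<lambda>t. deriv (u t)) \<xi> (deriv \<xi>) c\<^sub>0 C\<^sub>0 X"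
proof -
  from assms have wave: "generalized_traveling_wave f u" and \<xi>: "interface_location u \<xi>"
    and C1: "\<xi> C1_differentiable_on UNIV" and bdd: "bounded (range (deriv \<xi>))"
    and "\<forall>t. u t (\<xi> t) = \<theta>" and "\<forall>t x. deriv (u t) x < 0"
    and "\<forall>M>0. \<exists>C>0. \<forall>t. \<forall>x\<in>{-M..M}. deriv (u t) (x + \<xi> t) < - C"
    unfolding reference_wave_def by - ((elim conjE, assumption)+)
  then have u\<xi>: "\<And>t. u t (\<xi> t) = \<theta>" and neg: "\<And>t x. deriv (u t) x < 0"
    and steep: "\<And>M. M > 0 \<Longrightarrow> \<exists>C>0. \<forall>t. \<forall>x\<in>{-M..M}. deriv (u t) (x + \<xi> t) < - C"
    by simp_all
  have "\<exists>w. (\<exists>c\<^sub>0>0. \<forall>x\<ge>0. w x = \<theta> * exp (- c\<^sub>0 * x)) \<and> (\<forall>t. \<forall>x\<ge>0. u t (x + \<xi> t) \<le> w x) \<and>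
      (\<exists>C>0. \<forall>t. \<forall>x\<ge>0. deriv (u t) (x + \<xi> t) \<ge> - C * w x)"
    using assms unfolding reference_wave_def
    by - (elim conjE, erule ex_forward, elim conjE, intro conjI; assumption)
  then obtain w where "(\<exists>c\<^sub>0>0. \<forall>x\<ge>0. w x = \<theta> * exp (- c\<^sub>0 * x)) \<and> (\<forall>t. \<forall>x\<ge>0. u t (x + \<xi> t) \<le> w x) \<and>
      (\<exists>C>0. \<forall>t. \<forall>x\<ge>0. deriv (u t) (x + \<xi> t) \<ge> - C * w x)" by (rule exE)
  then obtain c\<^sub>0 C where c0: "c\<^sub>0 > 0" and w: "\<And>x. x \<ge> 0 \<Longrightarrow> w x = \<theta> * exp (- c\<^sub>0 * x)"
    and uw: "\<forall>t. \<forall>x\<ge>0. u t (x + \<xi> t) \<le> w x"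
    and C: "C > 0" "\<And>t x. x \<ge> 0 \<Longrightarrow> deriv (u t) (x + \<xi> t) \<ge> - C * w x"
    by auto
  have classical: "entire_classical_solution f u"
    using wave unfolding generalized_traveling_wave_def by blast
  obtain X where X: "\<And>t. \<bar>deriv \<xi> t\<bar> \<le> X"
    using bdd unfolding bounded_iff by auto
  have \<xi>_deriv: "(\<xi> has_real_derivative deriv \<xi> t) (at t)" for t
  proof -
    obtain D where "(\<xi> has_vector_derivative D t) (at t)"
      using C1 unfolding C1_differentiable_on_def by blast
    then have "(\<xi> has_real_derivative D t) (at t)"
      by (simp add: has_real_derivative_iff_has_vector_derivative)
    then show ?thesis using DERIV_imp_deriv by metis
  qed
  have u_deriv: "(u t has_real_derivative deriv (u t) x) (at x)" for t x
    using classical unfolding entire_classical_solution_def by (metis DERIV_imp_deriv)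
  have "ignition_front f \<theta> \<theta>' \<beta> L u (\<lambda>t. deriv (u t)) \<xi> (deriv \<xi>) c\<^sub>0 (C * \<theta>) X"
  proof
    show "- (C * \<theta> * exp (- c\<^sub>0 * y)) \<le> deriv (u t) (y + \<xi> t)" if "0 \<le> y" for y t
      using C(2)[OF that, of t] w[OF that] by (simp add: mult.assoc)
    show "u t (y + \<xi> t) \<le> \<theta> * exp (- c\<^sub>0 * y)" if "0 \<le> y" for y t
      using uw[rule_format, OF that, of t] w[OF that] by simp
  qed (use solution_of_wave[OF wave] \<xi> moving_frame_heat_op[OF classical] u_deriv neg steep c0 C(1)
      theta \<xi>_deriv X u\<xi> in auto)
  then show thesis by (rule that)
qed

lemma reference_wave_unique:
  assumes "reference_wave f \<theta> u \<xi>" and wave: "generalized_traveling_wave f v"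
  shows "\<exists>\<zeta>. \<forall>t x. v t x = u t (x + \<zeta>)"
proof -
  obtain c\<^sub>0 C\<^sub>0 X where "ignition_front f \<theta> \<theta>' \<beta> L u (\<lambda>t. deriv (u t)) \<xi> (deriv \<xi>) c\<^sub>0 C\<^sub>0 X"
    using front_of_reference_wave[OF assms(1)] .
  then interpret ignition_front f \<theta> \<theta>' \<beta> L u "\<lambda>t. deriv (u t)" \<xi> "deriv \<xi>" c\<^sub>0 C\<^sub>0 X .
  obtain c where c: "c > 0" and front_speed: "\<And>v \<eta>. solution v \<Longrightarrow> interface_location v \<eta> \<Longrightarrow>
     \<exists>K. \<forall>s t. s \<le> t \<longrightarrow> \<eta> s + c * (t - s) - K \<le> \<eta> t"
    using front_speed_positive by blast
  obtain K where K: "\<And>s t. s \<le> t \<Longrightarrow> \<xi> s + c * (t - s) - K \<le> \<xi> t"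
    using front_speed[OF U U_interface] by blast
  interpret ignition_front_speed f \<theta> \<theta>' \<beta> L u "\<lambda>t. deriv (u t)" \<xi> "deriv \<xi>" c\<^sub>0 C\<^sub>0 X c K "min c c\<^sub>0 / 2"
    by unfold_locales (use K c c0_pos in auto)
  obtain \<eta> where \<eta>: "interface_location v \<eta>"
    using wave unfolding generalized_traveling_wave_def by blast
  have v: "solution v" using solution_of_wave[OF wave] .
  obtain K' where K': "\<And>s t. s \<le> t \<Longrightarrow> \<eta> s + c * (t - s) - K' \<le> \<eta> t"
    using front_speed[OF v \<eta>] by blast
  obtain C where "0 < C" "\<And>t x. v t x \<le> C * exp (- c * (x - \<eta> t))"
    using wave_tail[OF v \<eta> c K'] by blast
  then show ?thesis by (rule wave_is_translate[OF v \<eta>])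
qed

end

theorem theorem1p5:
  fixes f :: "real \<Rightarrow> real \<Rightarrow> real" and \<theta> :: real
    and u_f :: "real \<Rightarrow> real \<Rightarrow> real" and \<xi>_f :: "real \<Rightarrow> real"
  assumes "H1 f \<theta>" and "H2 f \<theta>" and "H3 f \<theta>"
    and "reference_wave f \<theta> u_f \<xi>_f"
  shows "(\<forall>v. generalized_traveling_wave f v \<longrightarrow>
            (\<exists>\<zeta>. \<forall>t x. v t x = u_f t (x + \<zeta>))) \<and>
         (\<forall>v\<^sub>1 v\<^sub>2. generalized_traveling_wave f v\<^sub>1 \<and> generalized_traveling_wave f v\<^sub>2 \<longrightarrow>
            (\<exists>\<zeta>. \<forall>t x. v\<^sub>1 t x = v\<^sub>2 t (x + \<zeta>)))"
proof -
  obtain \<theta>' \<beta> L where "ignition f \<theta> \<theta>' \<beta> L"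
    using ignition_from_hypotheses[OF assms(1-3)] .
  then interpret ignition f \<theta> \<theta>' \<beta> L .
  have unique: "\<exists>\<zeta>. \<forall>t x. v t x = u_f t (x + \<zeta>)" if "generalized_traveling_wave f v" for v
    using reference_wave_unique[OF assms(4) that] .
  moreover have "\<exists>\<zeta>. \<forall>t x. v\<^sub>1 t x = v\<^sub>2 t (x + \<zeta>)"
    if v\<^sub>1: "generalized_traveling_wave f v\<^sub>1" and v\<^sub>2: "generalized_traveling_wave f v\<^sub>2" for v\<^sub>1 v\<^sub>2
  proof -
    obtain \<zeta>\<^sub>1 \<zeta>\<^sub>2 where \<zeta>: "\<And>t x. v\<^sub>1 t x = u_f t (x + \<zeta>\<^sub>1)" "\<And>t x. v\<^sub>2 t x = u_f t (x + \<zeta>\<^sub>2)"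
      using unique[OF v\<^sub>1] unique[OF v\<^sub>2] by blast
    then have "v\<^sub>1 t x = v\<^sub>2 t (x + (\<zeta>\<^sub>1 - \<zeta>\<^sub>2))" for t x by simp
    then show ?thesis by blast
  qed
  ultimately show ?thesis by blast
qed

end
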